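(* There is a constant $C$ such that, for every $n\ge 3$, every face-convex drawing $D$ of $K_n$ in the sphere has at least $n^2-C\,n\log n$ empty triangles. (That is, $D$ has at least $n^2+O(n\log n)$ empty triangles.)
   Context: Drawings: vertices are represented by distinct points, and each edge by a simple arc joining its end vertices and containing no other vertex; two edges meet only at common end vertices or at (finitely many) crossings. All drawings are good: no two edges incident with a common vertex cross; no three edges cross at a common point; no two edges cross each other more than once. For a subgraph $H$ of $K_n$, $D[H]$ is the subdrawing of $D$ induced by $H$ (also viewed as a point set). A face of $D$ is a component of the complement of $D[K_n]$. For a drawing $D$ of $K_n$ in the sphere and a 3-cycle (triangle) $T$ of $K_n$, $D[T]$ is a simple closed curve and bounds two closed discs. A closed disc $\Delta$ bounded by $D[T]$ is convex if, for any distinct vertices $u,v$ of $K_n$ with $D[u],D[v]\in\Delta$, we have $D[uv]\subseteq\Delta$. The drawing $D$ is face-convex if there is a face $F$ of $D$ such that, for every triangle $T$ of $K_n$, the closed disc bounded by $D[T]$ and not containing $F$ is convex. An empty triangle of $D$ is an open disc $\Delta$ bounded by $D[xyz]$, for some 3-cycle $xyz$ of $K_n$, such that $\Delta$ contains no point $D[v]$ with $v\in V(K_n)$. *)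

theory Defs
  imports "HOL-Analysis.Analysis"
begin

abbreviation S2 :: "(real ^ 3) set" where
  "S2 \<equiv> sphere 0 1"

definition complete_edges :: "nat set \<Rightarrow> nat set set" where
  "complete_edges W = {e. e \<subseteq> W \<and> card e = 2}"

text \<open>The vertices of \<open>K\<^sub>n\<close> are \<open>0, \<dots>, n - 1\<close>. The fields of a drawing are only constrained
  (by \<open>is_drawing\<close>) on these vertices and on the two-element sets of these vertices.\<close>

record drawing =
  vertex :: "nat \<Rightarrow> real ^ 3"
  edge :: "nat set \<Rightarrow> (real ^ 3) set"

text \<open>A crossing is topologically transversal: in a neighbourhood of the point the two arcs look
  like the two coordinate axes at the origin. In particular a crossing is an interior point
  of both arcs, and a point where the arcs only touch is not a crossing.\<close>

definition crosses_at :: "(real ^ 3) set \<Rightarrow> (real ^ 3) set \<Rightarrow> real ^ 3 \<Rightarrow> bool" where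
  "crosses_at A B p \<longleftrightarrow>
     (\<exists>U (h :: real ^ 3 \<Rightarrow> complex) k.
        openin (top_of_set S2) U \<and> p \<in> U \<and>
        homeomorphism U (ball 0 1) h k \<and> h p = 0 \<and>
        h ` (U \<inter> A) = {z \<in> ball 0 1. Im z = 0} \<and>
        h ` (U \<inter> B) = {z \<in> ball 0 1. Re z = 0})"

definition is_drawing :: "nat \<Rightarrow> drawing \<Rightarrow> bool" where
  "is_drawing n D \<longleftrightarrow>
     inj_on (vertex D) {..<n} \<and>
     vertex D ` {..<n} \<subseteq> S2 \<and>
     (\<forall>u<n. \<forall>v<n. u \<noteq> v \<longrightarrow>
        (\<exists>g. arc g \<and> pathstart g = vertex D u \<and> pathfinish g = vertex D v \<and>
             path_image g = edge D {u, v})) \<and>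
     (\<forall>e\<in>complete_edges {..<n}. edge D e \<subseteq> S2 \<and>
        (\<forall>w<n. w \<notin> e \<longrightarrow> vertex D w \<notin> edge D e)) \<and>
     (\<forall>e\<in>complete_edges {..<n}. \<forall>f\<in>complete_edges {..<n}. e \<noteq> f \<longrightarrow>
        edge D e \<inter> edge D f \<subseteq> vertex D ` (e \<inter> f) \<union> {p. crosses_at (edge D e) (edge D f) p} \<and>
        finite {p. crosses_at (edge D e) (edge D f) p})"

definition good_drawing :: "nat \<Rightarrow> drawing \<Rightarrow> bool" where
  "good_drawing n D \<longleftrightarrow>
     is_drawing n D \<and>
     (\<forall>e\<in>complete_edges {..<n}. \<forall>f\<in>complete_edges {..<n}. e \<noteq> f \<and> e \<inter> f \<noteq> {} \<longrightarrow>
        \<not> (\<exists>p. crosses_at (edge D e) (edge D f) p)) \<and>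
     (\<forall>e\<in>complete_edges {..<n}. \<forall>f\<in>complete_edges {..<n}. \<forall>g\<in>complete_edges {..<n}.
        e \<noteq> f \<and> e \<noteq> g \<and> f \<noteq> g \<longrightarrow>
        \<not> (\<exists>p. crosses_at (edge D e) (edge D f) p \<and> crosses_at (edge D e) (edge D g) p \<and>
               crosses_at (edge D f) (edge D g) p)) \<and>
     (\<forall>e\<in>complete_edges {..<n}. \<forall>f\<in>complete_edges {..<n}. e \<noteq> f \<longrightarrow>
        (\<forall>p q. crosses_at (edge D e) (edge D f) p \<and> crosses_at (edge D e) (edge D f) q \<longrightarrow> p = q))"

text \<open>The point set of the subdrawing induced by the complete subgraph on \<open>W\<close>; for
  \<open>W = {..<n}\<close> this is \<open>D[K\<^sub>n]\<close>, and for \<open>card W = 3\<close> it is \<open>D[T]\<close> for the 3-cycle \<open>T\<close> on \<open>W\<close>.\<close>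

definition subdrawing :: "drawing \<Rightarrow> nat set \<Rightarrow> (real ^ 3) set" where
  "subdrawing D W = vertex D ` W \<union> (\<Union>e\<in>complete_edges W. edge D e)"

definition triangles :: "nat \<Rightarrow> nat set set" where
  "triangles n = {T. T \<subseteq> {..<n} \<and> card T = 3}"

definition faces :: "nat \<Rightarrow> drawing \<Rightarrow> (real ^ 3) set set" where
  "faces n D = components (S2 - subdrawing D {..<n})"

definition closed_disc_bounded_by :: "(real ^ 3) set \<Rightarrow> (real ^ 3) set \<Rightarrow> bool" where
  "closed_disc_bounded_by \<Delta> J \<longleftrightarrow>
     \<Delta> \<subseteq> S2 \<and>
     (\<exists>(h :: complex \<Rightarrow> real ^ 3) k. homeomorphism (cball 0 1) \<Delta> h k \<and> h ` sphere 0 1 = J)"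

definition open_disc_bounded_by :: "(real ^ 3) set \<Rightarrow> (real ^ 3) set \<Rightarrow> bool" where
  "open_disc_bounded_by \<Delta> J \<longleftrightarrow> (\<exists>\<Delta>'. closed_disc_bounded_by \<Delta>' J \<and> \<Delta> = \<Delta>' - J)"

definition convex_disc :: "nat \<Rightarrow> drawing \<Rightarrow> (real ^ 3) set \<Rightarrow> bool" where
  "convex_disc n D \<Delta> \<longleftrightarrow>
     (\<forall>u<n. \<forall>v<n. u \<noteq> v \<and> vertex D u \<in> \<Delta> \<and> vertex D v \<in> \<Delta> \<longrightarrow> edge D {u, v} \<subseteq> \<Delta>)"

text \<open>Since \<open>F\<close> is disjoint from \<open>D[T]\<close>, exactly one of the two closed discs bounded by \<open>D[T]\<close>
  does not contain \<open>F\<close>; the existential quantifier over \<open>\<Delta>\<close> therefore refers to that disc.\<close>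

definition face_convex :: "nat \<Rightarrow> drawing \<Rightarrow> bool" where
  "face_convex n D \<longleftrightarrow>
     (\<exists>F\<in>faces n D. \<forall>T\<in>triangles n.
        \<exists>\<Delta>. closed_disc_bounded_by \<Delta> (subdrawing D T) \<and> \<not> F \<subseteq> \<Delta> \<and> convex_disc n D \<Delta>)"

definition empty_triangles :: "nat \<Rightarrow> drawing \<Rightarrow> (real ^ 3) set set" where
  "empty_triangles n D =
     {\<Delta>. \<exists>T\<in>triangles n. open_disc_bounded_by \<Delta> (subdrawing D T) \<and> (\<forall>v<n. vertex D v \<notin> \<Delta>)}"

end

theory Submission
  imports Defs "HOL-Complex_Analysis.Complex_Analysis"
begin

text \<open>Project the sphere stereographically from a point of the distinguished face \<open>F\<close>. The disc of a
  triangle that avoids \<open>F\<close> becomes the inside of a Jordan curve, and the winding numbers of the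
  triangles \<open>abc\<close>, \<open>abd\<close>, \<open>acd\<close>, \<open>bcd\<close> about a point satisfy a cocycle relation. Together with
  convexity this makes the orientations of the triangles behave like those of a planar point set.

  The combinatorial bound follows Barany and Furedi. Some vertex \<open>t\<close> lies inside no triangle, and the
  rotation around \<open>t\<close> orders the remaining vertices linearly. If \<open>p < q\<close> and some vertex between them
  lies above \<open>pq\<close>, then one such vertex spans an empty triangle with \<open>pq\<close>; likewise below. So
  every pair contributes two empty triangles, unless \<open>p\<close> and \<open>q\<close> are consecutive, or all vertices
  between them lie on one side of \<open>pq\<close> and exactly one of them, \<open>r\<close>, works. For exceptional pairs with
  a common end the points \<open>r\<close> interlace with the other ends, so that the distances (in the linear order)
  of the pairs with \<open>r\<close> in the half next to the common end at least double. Hence only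
  \<open>O(n log n)\<close> pairs are exceptional.\<close>

section \<open>Empty triangles in abstract triangle systems\<close>

text \<open>Every element other than the maximum \<open>b\<close> is at most \<open>b div 2\<close>,
  so removing the maximum halves the bound in the induction. The factor 2 on the right accounts for
  the last remaining element.\<close>

lemma doubling_card:
  fixes A :: "nat set"
  assumes "finite A" "\<And>x. x \<in> A \<Longrightarrow> 1 \<le> x \<and> x \<le> N" "1 \<le> N"
    and "\<And>x y. \<lbrakk>x \<in> A; y \<in> A; x < y\<rbrakk> \<Longrightarrow> 2 * x \<le> y"
  shows "2 ^ card A \<le> 2 * N"
  using assms
proof (induction A arbitrary: N rule: finite_linorder_max_induct)
  case (insert b A)
  show ?case
  proof (cases "A = {}")
    case False
    then obtain a where a: "a \<in> A" by blast
    have half: "1 \<le> x \<and> x \<le> b div 2" if "x \<in> A" for x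
      using insert.prems(1)[of x] insert.prems(3)[of x b] insert.hyps(2) that by fastforce
    have "2 ^ card A \<le> 2 * (b div 2)"
    proof (rule insert.IH[OF half])
      show "1 \<le> b div 2" using half[OF a] by linarith
      show "\<And>x y. \<lbrakk>x \<in> A; y \<in> A; x < y\<rbrakk> \<Longrightarrow> 2 * x \<le> y" using insert.prems(3) by blast
    qed
    moreover have "b \<le> N" "b \<notin> A" using insert.prems(1) insert.hyps by blast+
    ultimately show ?thesis using insert.hyps(1) by simp
  qed (use insert.prems in simp)
qed simp

text \<open>\<open>ins s a b c\<close> stands for: \<open>s\<close> lies strictly inside the triangle \<open>abc\<close>.\<close>

locale triangle_system =
  fixes V :: "'a set"
    and ccw :: "'a \<Rightarrow> 'a \<Rightarrow> 'a \<Rightarrow> bool"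
    and ins :: "'a \<Rightarrow> 'a \<Rightarrow> 'a \<Rightarrow> 'a \<Rightarrow> bool"
  assumes finite_V: "finite V"
    and ccw_rotate: "\<lbrakk>distinct [a, b, c]; {a, b, c} \<subseteq> V\<rbrakk> \<Longrightarrow> ccw b c a \<longleftrightarrow> ccw a b c"
    and ccw_swap: "\<lbrakk>distinct [a, b, c]; {a, b, c} \<subseteq> V\<rbrakk> \<Longrightarrow> ccw b a c \<longleftrightarrow> \<not> ccw a b c"
    and ins_dom: "ins s a b c \<Longrightarrow> distinct [s, a, b, c] \<and> {s, a, b, c} \<subseteq> V"
    and ins_rotate: "ins s a b c \<Longrightarrow> ins s b c a"
    and ins_swap: "ins s a b c \<Longrightarrow> ins s b a c"
    and ins_orient: "ins s a b c \<Longrightarrow> ccw s a b \<longleftrightarrow> ccw a b c"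
    and ins_trans: "\<lbrakk>ins s a b c; ins u s a b\<rbrakk> \<Longrightarrow> ins u a b c"
    and ins_cover: "\<lbrakk>ins s a b c; d \<in> V; d \<notin> {s, a, b, c}\<rbrakk> \<Longrightarrow>
      ins s a b d \<or> ins s a c d \<or> ins s b c d"
    and ins_intro: "\<lbrakk>distinct [t, p, q, r]; {t, p, q, r} \<subseteq> V; ccw t p q; ccw t q r; ccw t r p\<rbrakk> \<Longrightarrow>
      ins t p q r"
begin

lemma ins_perms:
  assumes "ins s a b c"
  shows "ins s a c b" "ins s b a c" "ins s b c a" "ins s c a b" "ins s c b a"
  using assms ins_rotate ins_swap by blast+

lemma ccw_perms:
  assumes "distinct [a, b, c]" "{a, b, c} \<subseteq> V"
  shows "ccw b c a \<longleftrightarrow> ccw a b c" "ccw c a b \<longleftrightarrow> ccw a b c"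
    "ccw b a c \<longleftrightarrow> \<not> ccw a b c" "ccw a c b \<longleftrightarrow> \<not> ccw a b c" "ccw c b a \<longleftrightarrow> \<not> ccw a b c"
proof -
  show 1: "ccw b c a \<longleftrightarrow> ccw a b c" by (rule ccw_rotate[OF assms])
  show 2: "ccw c a b \<longleftrightarrow> ccw a b c"
    using ccw_rotate[of b c a] assms 1 by auto
  show "ccw b a c \<longleftrightarrow> \<not> ccw a b c" by (rule ccw_swap[OF assms])
  show "ccw a c b \<longleftrightarrow> \<not> ccw a b c" using ccw_swap[of c a b] assms 2 by auto
  show "ccw c b a \<longleftrightarrow> \<not> ccw a b c" using ccw_swap[of b c a] assms 1 by auto
qed

text \<open>Vertices are added one at a time. If the new vertex \<open>v\<close> is in no triangle
  of the enlarged set, it is extreme itself. Otherwise the old extreme vertex \<open>t\<close>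
  survives: a triangle \<open>vxy\<close> around \<open>t\<close>, combined with a triangle of
  \<open>S\<close> around \<open>v\<close>, would give a triangle of \<open>S\<close> around
  \<open>t\<close>.\<close>

lemma exists_extreme:
  assumes "finite S" "S \<noteq> {}" "S \<subseteq> V"
  shows "\<exists>t\<in>S. \<forall>a\<in>S. \<forall>b\<in>S. \<forall>c\<in>S. \<not> ins t a b c"
  using assms
proof (induction S rule: finite_ne_induct)
  case (singleton x)
  then show ?case using ins_dom by fastforce
next
  case (insert v S)
  then obtain t where tS: "t \<in> S" and t: "\<And>a b c. a \<in> S \<Longrightarrow> b \<in> S \<Longrightarrow> c \<in> S \<Longrightarrow> \<not> ins t a b c"
    by blast
  have SV: "S \<subseteq> V" "v \<in> V" using insert.prems by auto
  show ?case
  proof (cases "\<exists>a\<in>insert v S. \<exists>b\<in>insert v S. \<exists>c\<in>insert v S. ins v a b c")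
    case False
    then show ?thesis by blast
  next
    case True
    then obtain a b c where abc: "a \<in> S" "b \<in> S" "c \<in> S" "ins v a b c"
      using ins_dom by fastforce
    have no: "\<not> ins t v x y" if xy: "x \<in> S" "y \<in> S" for x y
    proof
      assume I: "ins t v x y"
      have d: "t \<noteq> v" "t \<noteq> x" "t \<noteq> y" "v \<noteq> x" "v \<noteq> y" "x \<noteq> y"
        using ins_dom[OF I] by auto
      \<comment> \<open>Covering \<open>abc\<close> from \<open>x\<close> yields a triangle of
        \<open>S\<close> around \<open>v\<close> that has \<open>x\<close> as a corner.\<close>
      obtain a' b' where ab: "a' \<in> S" "b' \<in> S" "ins v a' b' x"
      proof (cases "x \<in> {a, b, c}")
        case True
        then show ?thesis using that abc ins_perms[OF abc(4)] by blast
      next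
        case False
        then show ?thesis using that abc ins_cover[OF abc(4), of x] xy SV d by blast
      qed
      have w: "\<not> ins v w x y" if "w \<in> S" for w
      proof
        assume "ins v w x y"
        from ins_perms(3)[OF this] have "ins v x y w" .
        from ins_trans[OF this I] show False using t that xy by blast
      qed
      \<comment> \<open>By \<open>w\<close>, no triangle of \<open>S\<close> around \<open>v\<close>
        has both corners \<open>x\<close> and \<open>y\<close>. Covering \<open>a'b'x\<close> from
        \<open>y\<close> therefore leaves only \<open>a'b'y\<close>.\<close>
      have yab: "y \<notin> {a', b'}"
        using w ab ins_perms[OF ab(3)] by blast
      with ins_cover[OF ab(3), of y] xy SV d w ab have aby: "ins v a' b' y"
        by blast
      \<comment> \<open>At least one of \<open>a'\<close>, \<open>b'\<close> differs from
        \<open>t\<close>, as \<open>ins_cover\<close> requires; it becomes \<open>e\<close>.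
        Covering \<open>vxy\<close> from \<open>e\<close> then puts \<open>t\<close> into
        \<open>vxe\<close>, \<open>vye\<close> or \<open>xye\<close>; the first two lie in the
        triangles \<open>efx\<close> and \<open>efy\<close> of \<open>S\<close>, and the third is
        itself a triangle of \<open>S\<close>.\<close>
      obtain e f where ef: "e \<in> S" "f \<in> S" "e \<noteq> t" "ins v e f x" "ins v e f y"
        using ab aby ins_perms(2) ins_dom by (metis distinct_length_2_or_more)
      have "e \<notin> {t, v, x, y}" using ef ins_dom by fastforce
      with ins_cover[OF I, of e] ef SV have "ins t v x e \<or> ins t v y e \<or> ins t x y e" by blast
      moreover have "\<not> ins t v x e"
        using ins_trans[OF ins_perms(1)[OF ef(4)], of t] ins_perms(1)[of t v x e] t ef xy by blast
      moreover have "\<not> ins t v y e"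
        using ins_trans[OF ins_perms(1)[OF ef(5)], of t] ins_perms(1)[of t v y e] t ef xy by blast
      ultimately show False using t xy ef by blast
    qed
    have "\<not> ins t x y z" if xyz: "x \<in> insert v S" "y \<in> insert v S" "z \<in> insert v S" for x y z
    proof
      assume I: "ins t x y z"
      consider "x \<in> S" "y \<in> S" "z \<in> S" | "x = v" "y \<in> S" "z \<in> S"
        | "y = v" "x \<in> S" "z \<in> S" | "z = v" "x \<in> S" "y \<in> S"
        using xyz ins_dom[OF I] by auto
      then show False
        by cases (use I t no ins_perms[OF I] in blast)+
    qed
    then show ?thesis using tS by (intro bexI[of _ t] ballI insertI2)
  qed
qed

end

section \<open>The linear order around an extreme vertex\<close>

locale triangle_system_extreme = triangle_system +
  fixes t
  assumes t_in: "t \<in> V" and t_extreme: "\<not> ins t a b c"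
begin

definition W where "W = V - {t}"

text \<open>Compares directions as seen from \<open>t\<close>. For a general vertex such a relation
  may be cyclic; it becomes a strict linear order because \<open>t\<close> is extreme.\<close>

definition lt (infix "\<sqsubset>" 50) where
  "p \<sqsubset> q \<longleftrightarrow> p \<in> W \<and> q \<in> W \<and> p \<noteq> q \<and> ccw t p q"

lemma lt_dom: "p \<sqsubset> q \<Longrightarrow> p \<in> W \<and> q \<in> W \<and> p \<noteq> q"
  by (simp add: lt_def)

lemma lt_linear: "\<lbrakk>p \<in> W; q \<in> W; p \<noteq> q\<rbrakk> \<Longrightarrow> p \<sqsubset> q \<or> q \<sqsubset> p"
  using ccw_swap[of t p q] ccw_rotate[of p t q] ccw_rotate[of t q p] t_in
  by (auto simp: lt_def W_def)

lemma lt_asym: "p \<sqsubset> q \<Longrightarrow> \<not> q \<sqsubset> p"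
  using ccw_swap[of t p q] ccw_rotate[of p t q] ccw_rotate[of t q p] t_in
  by (auto simp: lt_def W_def)

text \<open>By \<open>ins_intro\<close>, a cycle of three vertices in this relation would enclose
  \<open>t\<close>.\<close>

lemma lt_trans: assumes "p \<sqsubset> q" "q \<sqsubset> r" shows "p \<sqsubset> r"
proof (rule ccontr)
  assume "\<not> p \<sqsubset> r"
  moreover have "p \<noteq> r" using assms lt_asym by blast
  ultimately have "r \<sqsubset> p" using lt_linear lt_dom assms by blast
  then have "ins t p q r"
    using assms \<open>p \<noteq> r\<close> t_in by (intro ins_intro) (auto simp: lt_def W_def)
  then show False using t_extreme by blast
qed

lemma finite_W: "finite W" by (simp add: W_def finite_V)

definition between where "between p q = {r. p \<sqsubset> r \<and> r \<sqsubset> q}"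

definition empty_tri where "empty_tri p q r \<longleftrightarrow> (\<forall>v. \<not> ins v p q r)"

text \<open>By \<open>ins_orient\<close>, the triangles \<open>stx\<close> and \<open>syt\<close>
  are oriented like \<open>txy\<close>, and this is the order of \<open>x\<close>, \<open>s\<close>,
  \<open>y\<close> around \<open>t\<close>.\<close>

lemma ins_between_pair:
  assumes "ins s t x y" "x \<sqsubset> y"
  shows "x \<sqsubset> s" "s \<sqsubset> y"
proof -
  have d: "distinct [s, t, x, y]" "{s, t, x, y} \<subseteq> V" using ins_dom[OF assms(1)] by auto
  have xy: "ccw t x y" using assms(2) by (simp add: lt_def)
  have "ccw s t x" using ins_orient[OF assms(1)] xy by blast
  then have "ccw t x s" using ccw_rotate[of s t x] d by auto
  then show "x \<sqsubset> s" using d by (auto simp: lt_def W_def)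
  have "ccw s y t" 
    using ins_orient[of s y t x] ins_perms(4)[OF assms(1)] xy ccw_rotate[of t x y] ccw_rotate[of x y t] d by auto
  then have "ccw t s y" using ccw_rotate[of s y t] ccw_rotate[of y t s] d by auto
  then show "s \<sqsubset> y" using d by (auto simp: lt_def W_def)
qed

text \<open>Covering \<open>pqr\<close> from \<open>t\<close> puts \<open>s\<close> into a triangle
  with corner \<open>t\<close> and two corners among \<open>p\<close>, \<open>q\<close>,
  \<open>r\<close>. There \<open>ins_between_pair\<close> applies.\<close>

lemma ins_between:
  assumes I: "ins s p q r" and r: "r \<in> between p q"
  shows "s \<in> between p q"
proof -
  have s: "s \<noteq> t" using I t_extreme by blast
  have o: "p \<sqsubset> r" "r \<sqsubset> q" "p \<sqsubset> q" using r lt_trans by (auto simp: between_def)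
  have "t \<notin> {s, p, q, r}" using s o lt_dom by (auto simp: W_def)
  then consider "ins s p q t" | "ins s p r t" | "ins s q r t"
    using ins_cover[OF I t_in] by blast
  then show ?thesis
  proof cases
    case 1
    show ?thesis
      using ins_between_pair[OF ins_perms(4)[OF 1]] o by (simp add: between_def)
  next
    case 2
    show ?thesis
      using ins_between_pair[OF ins_perms(4)[OF 2]] o lt_trans[of s r q] by (simp add: between_def)
  next
    case 3
    show ?thesis
      using ins_between_pair[OF ins_perms(5)[OF 3]] o lt_trans[of p r s] by (simp add: between_def)
  qed
qed

text \<open>Descent: a vertex \<open>b\<close> inside \<open>pqa\<close> is again between
  \<open>p\<close> and \<open>q\<close> and on the same side of \<open>pq\<close> as
  \<open>a\<close>, and \<open>pqb\<close> contains strictly fewer vertices than \<open>pqa\<close>.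
  The last conjunct, that the result is \<open>a\<close> or inside \<open>pqa\<close>, drives the
  interlacing lemmas below.\<close>

lemma exists_empty:
  assumes "a \<in> between p q"
  shows "\<exists>r\<in>between p q. empty_tri p q r \<and> (ccw p q r \<longleftrightarrow> ccw p q a) \<and> (r = a \<or> ins r p q a)"
  using assms
proof (induction "card {v. ins v p q a}" arbitrary: a rule: less_induct)
  case less
  show ?case
  proof (cases "empty_tri p q a")
    case True
    then show ?thesis using less by blast
  next
    case False
    then obtain b where b: "ins b p q a" by (auto simp: empty_tri_def)
    have bb: "b \<in> between p q" using ins_between b less.prems by blast
    have db: "distinct [b, p, q, a]" "{b, p, q, a} \<subseteq> V" using ins_dom[OF b] by auto
    have tr: "ins v p q a" if "ins v p q b" for v
      using ins_trans[OF b] ins_perms(4)[OF that] by blast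
    have "{v. ins v p q b} \<subset> {v. ins v p q a}"
      using tr b ins_dom by fastforce
    moreover have "finite {v. ins v p q a}"
      by (rule finite_subset[OF _ finite_V]) (use ins_dom in blast)
    ultimately have "card {v. ins v p q b} < card {v. ins v p q a}"
      by (rule psubset_card_mono[rotated])
    from less.hyps[OF this bb] obtain r where
      r: "r \<in> between p q" "empty_tri p q r" "ccw p q r \<longleftrightarrow> ccw p q b" "r = b \<or> ins r p q b" by blast
    have "ccw b p q \<longleftrightarrow> ccw p q a" using ins_orient[OF b] .
    moreover have "ccw b p q \<longleftrightarrow> ccw p q b" using ccw_rotate[of b p q] db by auto
    ultimately show ?thesis using r tr b by blast
  qed
qed

section \<open>Ranks and exceptional pairs\<close>

definition rk where "rk p = card {x \<in> W. x \<sqsubset> p}"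

lemma rk_mono: assumes "p \<sqsubset> q" shows "rk p < rk q"
  unfolding rk_def
proof (rule psubset_card_mono)
  show "{x \<in> W. x \<sqsubset> p} \<subset> {x \<in> W. x \<sqsubset> q}"
    using assms lt_trans lt_dom lt_asym by blast
qed (simp add: finite_W)

lemma lt_if_rk_less: "\<lbrakk>p \<in> W; q \<in> W; rk p < rk q\<rbrakk> \<Longrightarrow> p \<sqsubset> q"
  using lt_linear rk_mono by (metis less_asym less_irrefl)

lemma rk_less: "p \<in> W \<Longrightarrow> rk p < card W"
  unfolding rk_def by (rule psubset_card_mono) (use finite_W lt_dom in blast)+

lemma inj_rk: "inj_on rk W"
  using rk_mono lt_linear by (metis inj_onI less_irrefl)

text \<open>The exceptional pairs with at least one vertex in between. Emptiness of
  \<open>pqr\<close> follows from \<open>exists_empty\<close>: some intermediate vertex spans an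
  empty triangle with \<open>pq\<close>, and that vertex can only be \<open>r\<close>.\<close>

definition lonely where
  "lonely \<sigma> p r q \<longleftrightarrow> r \<in> between p q \<and> (\<forall>s\<in>between p q. ccw p q s = \<sigma>) \<and>
     (\<forall>s\<in>between p q. empty_tri p q s \<longrightarrow> s = r)"

text \<open>Suppose \<open>r1\<close> came after \<open>p2\<close>. Then \<open>r1\<close> is
  between \<open>p2\<close> and \<open>q\<close>, hence on side \<open>\<sigma>\<close> of
  \<open>p2 q\<close>. But descending from \<open>p2\<close> over the pair \<open>p1 q\<close> must
  end at \<open>r1\<close>, so \<open>r1\<close> is inside \<open>p1 q p2\<close>, and this triangle
  lies on the opposite side of \<open>p2 q\<close>.\<close>

lemma lonely_common_right:
  assumes l1: "lonely \<sigma> p1 r1 q" and l2: "lonely \<sigma> p2 r2 q" and p: "p1 \<sqsubset> p2"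
  shows "rk r1 \<le> rk p2"
proof (rule ccontr)
  assume "\<not> rk r1 \<le> rk p2"
  moreover have "p2 \<sqsubset> r2" "r2 \<sqsubset> q" "p1 \<sqsubset> r1" "r1 \<sqsubset> q"
    using l1 l2 by (simp_all add: lonely_def between_def)
  then have o: "p1 \<sqsubset> r1" "r1 \<sqsubset> q" "p2 \<sqsubset> q" "r1 \<in> W" "p2 \<in> W"
    using lt_trans[of p2 r2 q] lt_dom by blast+
  ultimately have pr: "p2 \<sqsubset> r1" using lt_linear rk_mono by fastforce
  have r2: "r1 \<in> between p2 q" using o pr by (auto simp: between_def)
  have b2: "p2 \<in> between p1 q" using o p by (auto simp: between_def)
  have sig: "ccw p2 q r1 = \<sigma>" using l2 r2 by (auto simp: lonely_def)
  have sig': "ccw p1 q p2 = \<sigma>" using l1 b2 by (auto simp: lonely_def)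
  have "r1 \<noteq> p2" using lt_dom pr by blast
  moreover obtain r where "r \<in> between p1 q" "empty_tri p1 q r" "r = p2 \<or> ins r p1 q p2"
    using exists_empty[OF b2] by blast
  moreover from this have "r = r1" using l1 by (simp add: lonely_def)
  ultimately have "ins r1 p1 q p2" by blast
  then have I: "ins r1 p2 q p1" by (rule ins_perms)
  have d: "distinct [r1, p2, q, p1]" "{r1, p2, q, p1} \<subseteq> V" using ins_dom[OF I] by auto
  have "ccw r1 p2 q = ccw p2 q p1" using ins_orient[OF I] .
  moreover have "ccw p2 q r1 = ccw r1 p2 q" by (rule ccw_perms) (use d in auto)
  moreover have "ccw p2 q p1 = (\<not> ccw p1 q p2)"
    by (rule ccw_perms) (use d in auto)
  ultimately show False using sig sig' by simp
qed

text \<open>The mirror image of \<open>lonely_common_right\<close>: if \<open>r2\<close> came before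
  \<open>q1\<close>, descending from \<open>q1\<close> over \<open>p q2\<close> would end at
  \<open>r2\<close>, which would then be on both sides of \<open>p q1\<close>.\<close>

lemma lonely_common_left:
  assumes l1: "lonely \<sigma> p r1 q1" and l2: "lonely \<sigma> p r2 q2" and q: "q1 \<sqsubset> q2"
  shows "rk q1 \<le> rk r2"
proof (rule ccontr)
  assume "\<not> rk q1 \<le> rk r2"
  moreover have "p \<sqsubset> r1" "r1 \<sqsubset> q1" "p \<sqsubset> r2" "r2 \<sqsubset> q2"
    using l1 l2 by (simp_all add: lonely_def between_def)
  then have o: "p \<sqsubset> r2" "r2 \<sqsubset> q2" "p \<sqsubset> q1" "r2 \<in> W" "q1 \<in> W"
    using lt_trans[of p r1 q1] lt_dom by blast+
  ultimately have pr: "r2 \<sqsubset> q1" using lt_linear rk_mono by fastforce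
  have r1: "r2 \<in> between p q1" using o pr by (auto simp: between_def)
  have b2: "q1 \<in> between p q2" using o q by (auto simp: between_def)
  have sig: "ccw p q1 r2 = \<sigma>" using l1 r1 by (auto simp: lonely_def)
  have sig': "ccw p q2 q1 = \<sigma>" using l2 b2 by (auto simp: lonely_def)
  have "r2 \<noteq> q1" using lt_dom pr by blast
  moreover obtain r where "r \<in> between p q2" "empty_tri p q2 r" "r = q1 \<or> ins r p q2 q1"
    using exists_empty[OF b2] by blast
  moreover from this have "r = r2" using l2 by (simp add: lonely_def)
  ultimately have "ins r2 p q2 q1" by blast
  then have I: "ins r2 p q1 q2" by (rule ins_perms)
  have d: "distinct [r2, p, q1, q2]" "{r2, p, q1, q2} \<subseteq> V" using ins_dom[OF I] by auto
  have "ccw r2 p q1 = ccw p q1 q2" using ins_orient[OF I] .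
  moreover have "ccw p q1 r2 = ccw r2 p q1" by (rule ccw_perms) (use d in auto)
  moreover have "ccw p q1 q2 = (\<not> ccw p q2 q1)"
    by (rule ccw_perms) (use d in auto)
  ultimately show False using sig sig' by simp
qed

lemma rk_between:
  assumes "lonely \<sigma> p r q"
  shows "rk p < rk r" "rk r < rk q" "p \<in> W" "q \<in> W" "p \<sqsubset> q"
  using assms lt_trans[of p r q] lt_dom rk_mono unfolding lonely_def between_def by blast+

text \<open>For \<open>q1\<close> before \<open>q2\<close> among the counted ends, interlacing gives
  \<open>rk q1 \<le> rk r2\<close>, and \<open>r2\<close> is at most halfway from \<open>p\<close>
  to \<open>q2\<close>. So the distances from \<open>p\<close> at least double, and
  \<open>doubling_card\<close> applies to them.\<close>

lemma card_lonely_left: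
  assumes "W \<noteq> {}"
  shows "2 ^ card {q. \<exists>r. lonely \<sigma> p r q \<and> 2 * (rk r - rk p) \<le> rk q - rk p} \<le> 2 * card W"
    (is "2 ^ card ?X \<le> _")
proof -
  have XW: "?X \<subseteq> W" using rk_between by blast
  have inj: "inj_on (\<lambda>q. rk q - rk p) ?X"
  proof (rule inj_onI)
    fix x y assume "x \<in> ?X" "y \<in> ?X" "rk x - rk p = rk y - rk p"
    moreover from this obtain r r' where "lonely \<sigma> p r x" "lonely \<sigma> p r' y" by blast
    ultimately have "rk x = rk y" using rk_between[of \<sigma> p r x] rk_between[of \<sigma> p r' y] by linarith
    then show "x = y" using inj_rk XW \<open>x \<in> ?X\<close> \<open>y \<in> ?X\<close> by (meson inj_onD subsetD)
  qed
  have "2 ^ card ((\<lambda>q. rk q - rk p) ` ?X) \<le> 2 * card W"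
  proof (rule doubling_card)
    show "finite ((\<lambda>q. rk q - rk p) ` ?X)" using XW finite_W finite_subset by blast
    show "1 \<le> card W" using assms finite_W by (simp add: Suc_leI card_gt_0_iff)
  next
    fix x assume "x \<in> (\<lambda>q. rk q - rk p) ` ?X"
    then obtain q r where "x = rk q - rk p" "lonely \<sigma> p r q" by blast
    then show "1 \<le> x \<and> x \<le> card W"
      using rk_between[of \<sigma> p r q] rk_less[of q] by linarith
  next
    fix x y assume "x \<in> (\<lambda>q. rk q - rk p) ` ?X" "y \<in> (\<lambda>q. rk q - rk p) ` ?X" and xy: "x < y"
    then obtain q1 r1 q2 r2 where q1: "x = rk q1 - rk p" "lonely \<sigma> p r1 q1"
      and q2: "y = rk q2 - rk p" "lonely \<sigma> p r2 q2" "2 * (rk r2 - rk p) \<le> rk q2 - rk p" by blast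
    have "rk q1 < rk q2" using q1 q2 xy by linarith
    then have "q1 \<sqsubset> q2" by (rule lt_if_rk_less[OF rk_between(4)[OF q1(2)] rk_between(4)[OF q2(2)]])
    then have "rk q1 \<le> rk r2" by (rule lonely_common_left[OF q1(2) q2(2)])
    then show "2 * x \<le> y" using q1 q2 by linarith
  qed
  then show ?thesis using card_image[OF inj] by simp
qed

text \<open>The same doubling for distances measured from a common right end, by
  \<open>lonely_common_right\<close>.\<close>

lemma card_lonely_right:
  assumes "W \<noteq> {}"
  shows "2 ^ card {p. \<exists>r. lonely \<sigma> p r q \<and> 2 * (rk q - rk r) \<le> rk q - rk p} \<le> 2 * card W"
    (is "2 ^ card ?X \<le> _")
proof -
  have XW: "?X \<subseteq> W" using rk_between by blast
  have inj: "inj_on (\<lambda>p. rk q - rk p) ?X"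
  proof (rule inj_onI)
    fix x y assume "x \<in> ?X" "y \<in> ?X" "rk q - rk x = rk q - rk y"
    moreover from this obtain r r' where "lonely \<sigma> x r q" "lonely \<sigma> y r' q" by blast
    ultimately have "rk x = rk y" using rk_between[of \<sigma> x r q] rk_between[of \<sigma> y r' q] by linarith
    then show "x = y" using inj_rk XW \<open>x \<in> ?X\<close> \<open>y \<in> ?X\<close> by (meson inj_onD subsetD)
  qed
  have "2 ^ card ((\<lambda>p. rk q - rk p) ` ?X) \<le> 2 * card W"
  proof (rule doubling_card)
    show "finite ((\<lambda>p. rk q - rk p) ` ?X)" using XW finite_W finite_subset by blast
    show "1 \<le> card W" using assms finite_W by (simp add: Suc_leI card_gt_0_iff)
  next
    fix x assume "x \<in> (\<lambda>p. rk q - rk p) ` ?X"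
    then obtain p r where "x = rk q - rk p" "lonely \<sigma> p r q" by blast
    then show "1 \<le> x \<and> x \<le> card W"
      using rk_between[of \<sigma> p r q] rk_less[of q] by linarith
  next
    fix x y assume "x \<in> (\<lambda>p. rk q - rk p) ` ?X" "y \<in> (\<lambda>p. rk q - rk p) ` ?X" and xy: "x < y"
    then obtain p2 r2 p1 r1 where p2: "x = rk q - rk p2" "lonely \<sigma> p2 r2 q"
      and p1: "y = rk q - rk p1" "lonely \<sigma> p1 r1 q" "2 * (rk q - rk r1) \<le> rk q - rk p1" by blast
    have "rk p1 < rk p2" using p1 p2 xy by linarith
    then have "p1 \<sqsubset> p2" by (rule lt_if_rk_less[OF rk_between(3)[OF p1(2)] rk_between(3)[OF p2(2)]])
    then have "rk r1 \<le> rk p2" by (rule lonely_common_right[OF p1(2) p2(2)])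
    then show "2 * x \<le> y" using p1 p2 by linarith
  qed
  then show ?thesis using card_image[OF inj] by simp
qed

text \<open>The vertex \<open>r\<close> is in the half next to \<open>p\<close> or in the half next
  to \<open>q\<close>, measured by rank. Charging the pair to that end, each vertex is charged at
  most \<open>1 + log 2 (card W)\<close> times as a left end and as often as a right end.\<close>

lemma card_lonely:
  assumes "W \<noteq> {}"
  shows "real (card {(p, q). \<exists>r. lonely \<sigma> p r q}) \<le> 2 * real (card W) * (1 + log 2 (card W))"
proof -
  let ?A = "\<lambda>p. {q. \<exists>r. lonely \<sigma> p r q \<and> 2 * (rk r - rk p) \<le> rk q - rk p}"
  let ?B = "\<lambda>q. {p. \<exists>r. lonely \<sigma> p r q \<and> 2 * (rk q - rk r) \<le> rk q - rk p}"
  have W1: "card W \<ge> 1" using assms finite_W by (simp add: Suc_leI card_gt_0_iff)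
  have L: "real k \<le> 1 + log 2 (card W)" if "2 ^ k \<le> 2 * card W" for k
  proof -
    have "real (2 ^ k) \<le> real (2 * card W)" using that of_nat_le_iff by blast
    then have "2 ^ k \<le> 2 * real (card W)" by simp
    then have "log 2 (2 ^ k) \<le> log 2 (2 * real (card W))"
      using W1 by (intro log_mono) simp_all
    also have "\<dots> = 1 + log 2 (card W)" using W1 by (simp add: log_mult_pos)
    finally show ?thesis by simp
  qed
  have fin: "finite (?A p)" "finite (?B p)" for p
    by (rule finite_subset[OF _ finite_W]; use rk_between in blast)+
  have split: "2 * (rk r - rk p) \<le> rk q - rk p \<or> 2 * (rk q - rk r) \<le> rk q - rk p"
    if "lonely \<sigma> p r q" for p r q
    using rk_between[OF that] by linarith
  have "{(p, q). \<exists>r. lonely \<sigma> p r q} \<subseteq> Sigma W ?A \<union> prod.swap ` Sigma W ?B"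
  proof
    fix e assume "e \<in> {(p, q). \<exists>r. lonely \<sigma> p r q}"
    then obtain p q r where e: "e = (p, q)" and l: "lonely \<sigma> p r q" by blast
    have W: "p \<in> W" "q \<in> W" using rk_between[OF l] by blast+
    from split[OF l] show "e \<in> Sigma W ?A \<union> prod.swap ` Sigma W ?B"
    proof
      assume "2 * (rk r - rk p) \<le> rk q - rk p"
      then have "e \<in> Sigma W ?A" using l W e by blast
      then show ?thesis by blast
    next
      assume "2 * (rk q - rk r) \<le> rk q - rk p"
      then have "(q, p) \<in> Sigma W ?B" using l W by blast
      then show ?thesis using e by (intro UnI2 image_eqI[of _ _ "(q, p)"]) simp_all
    qed
  qed
  then have "card {(p, q). \<exists>r. lonely \<sigma> p r q} \<le> card (Sigma W ?A \<union> prod.swap ` Sigma W ?B)"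
    using fin finite_W by (intro card_mono) auto
  also have "\<dots> \<le> card (Sigma W ?A) + card (prod.swap ` Sigma W ?B)" by (rule card_Un_le)
  also have "card (prod.swap ` Sigma W ?B) = card (Sigma W ?B)" by (simp add: card_image)
  also have "card (Sigma W ?A) + card (Sigma W ?B) = (\<Sum>p\<in>W. card (?A p)) + (\<Sum>q\<in>W. card (?B q))"
    using fin finite_W by (simp add: card_SigmaI)
  finally have "real (card {(p, q). \<exists>r. lonely \<sigma> p r q})
      \<le> (\<Sum>p\<in>W. real (card (?A p))) + (\<Sum>q\<in>W. real (card (?B q)))"
    unfolding of_nat_sum[symmetric] of_nat_add[symmetric] of_nat_le_iff .
  also have "\<dots> \<le> (\<Sum>p\<in>W. 1 + log 2 (card W)) + (\<Sum>q\<in>W. 1 + log 2 (card W))"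
    by (intro add_mono sum_mono L card_lonely_left card_lonely_right assms)
  also have "\<dots> = 2 * real (card W) * (1 + log 2 (card W))" by simp
  finally show ?thesis .
qed

section \<open>Counting empty triangles over pairs\<close>

lemma ins_set:
  assumes "ins v a b c" "{a, b, c} = {p, q, r}"
  shows "ins v p q r"
proof -
  have "distinct [v, a, b, c]" using ins_dom[OF assms(1)] by blast
  moreover have "p \<in> {a, b, c}" "q \<in> {a, b, c}" "r \<in> {a, b, c}" "a \<in> {p, q, r}" "b \<in> {p, q, r}" "c \<in> {p, q, r}"
    using assms(2) by blast+
  ultimately consider "p = a" "q = b" "r = c" | "p = a" "q = c" "r = b" | "p = b" "q = a" "r = c"
    | "p = b" "q = c" "r = a" | "p = c" "q = a" "r = b" | "p = c" "q = b" "r = a" by auto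
  then show ?thesis using assms(1) ins_perms[OF assms(1)] by cases simp_all
qed

definition empties where
  "empties = {T. T \<subseteq> V \<and> card T = 3 \<and> (\<forall>a b c v. T = {a, b, c} \<longrightarrow> \<not> ins v a b c)}"

definition mid where "mid p q = {r \<in> between p q. empty_tri p q r}"

definition pairs where "pairs = {(p, q). p \<sqsubset> q}"

lemma finite_pairs: "finite pairs"
  by (rule finite_subset[of _ "W \<times> W"]) (use lt_dom finite_W in \<open>auto simp: pairs_def\<close>)

lemma finite_mid: "finite (mid p q)"
  by (rule finite_subset[OF _ finite_W]) (use lt_dom in \<open>auto simp: mid_def between_def\<close>)

lemma card_pairs: "2 * card pairs + card W = card W * card W"
proof -
  have eq: "W \<times> W = pairs \<union> prod.swap ` pairs \<union> (\<lambda>x. (x, x)) ` W"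
    using lt_dom lt_linear unfolding pairs_def by force
  have "card (W \<times> W) = card (pairs \<union> prod.swap ` pairs) + card ((\<lambda>x. (x, x)) ` W)"
    unfolding eq using lt_dom finite_pairs finite_W
    by (intro card_Un_disjoint) (auto simp: pairs_def)
  also have "card (pairs \<union> prod.swap ` pairs) = card pairs + card (prod.swap ` pairs)"
    using lt_asym finite_pairs by (intro card_Un_disjoint) (auto simp: pairs_def)
  also have "card (prod.swap ` pairs) = card pairs" by (simp add: card_image)
  also have "card ((\<lambda>x. (x, x)) ` W) = card W" by (simp add: card_image inj_on_def)
  finally show ?thesis by (simp add: card_cartesian_product)
qed

text \<open>No empty triple is counted twice: the pair consists of its first and last vertex in the
  linear order, and the third vertex is the one in the middle.\<close>

lemma sum_mid_le: "(\<Sum>(p, q)\<in>pairs. card (mid p q)) \<le> card empties"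
proof -
  let ?S = "SIGMA e:pairs. mid (fst e) (snd e)"
  let ?f = "\<lambda>e :: ('a \<times> 'a) \<times> 'a. {fst (fst e), snd (fst e), snd e}"
  have o: "p \<sqsubset> r \<and> r \<sqsubset> q \<and> p \<sqsubset> q \<and> empty_tri p q r" if "((p, q), r) \<in> ?S" for p q r
    using that by (auto simp: pairs_def mid_def between_def)
  have "inj_on ?f ?S"
  proof (rule inj_onI)
    fix x y assume xy: "x \<in> ?S" "y \<in> ?S" "?f x = ?f y"
    obtain p q r p' q' r' where x: "x = ((p, q), r)" and y: "y = ((p', q'), r')"
      by (metis surj_pair)
    have 1: "((p, q), r) \<in> ?S" and 2: "((p', q'), r') \<in> ?S" and eq: "{p, q, r} = {p', q', r'}"
      using xy unfolding x y by simp_all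
    have "p \<in> {p', q', r'}" "q \<in> {p', q', r'}" "r \<in> {p', q', r'}"
      using eq by auto
    moreover have "rk p < rk r" "rk r < rk q" "rk p' < rk r'" "rk r' < rk q'"
      using o[OF 1] o[OF 2] rk_mono by blast+
    ultimately show "x = y" unfolding x y by auto
  qed
  moreover have "?f ` ?S \<subseteq> empties"
  proof (rule image_subsetI)
    fix x assume "x \<in> ?S"
    moreover obtain p q r where x: "x = ((p, q), r)" by (metis surj_pair)
    ultimately have "((p, q), r) \<in> ?S" by blast
    from o[OF this] have o: "p \<sqsubset> r" "r \<sqsubset> q" "p \<sqsubset> q" "empty_tri p q r" by blast+
    then have "card {p, q, r} = 3" "{p, q, r} \<subseteq> V" using lt_dom by (auto simp: W_def card_insert_if)
    moreover have "\<not> ins v a b c" if "{p, q, r} = {a, b, c}" for a b c v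
      using ins_set[of v a b c p q r] that o by (auto simp: empty_tri_def)
    ultimately show "?f x \<in> empties" unfolding x by (auto simp: empties_def)
  qed
  moreover have "finite empties"
    by (rule finite_subset[of _ "Pow V"]) (auto simp: empties_def finite_V)
  ultimately have "card ?S \<le> card empties" by (rule card_inj_on_le)
  also have "card ?S = (\<Sum>e\<in>pairs. card (mid (fst e) (snd e)))"
    by (rule card_SigmaI) (auto simp: finite_pairs finite_mid)
  finally show ?thesis by (simp add: case_prod_beta)
qed

lemma card_empties:
  assumes "W \<noteq> {}"
  defines "m \<equiv> real (card W)"
  shows "real (card empties) \<ge> m\<^sup>2 - 11 * m - 8 * m * log 2 m"
proof -
  let ?adj = "{(p, q). p \<sqsubset> q \<and> between p q = {}}"
  let ?H = "\<lambda>\<sigma>. {(p, q). \<exists>r. lonely \<sigma> p r q}"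
  define bad where "bad = {(p, q)\<in>pairs. card (mid p q) < 2}"
  have sub: "bad \<subseteq> ?adj \<union> (?H True \<union> ?H False)"
  proof
    fix e assume "e \<in> bad"
    then obtain p q where e: "e = (p, q)" and pq: "p \<sqsubset> q" and c: "card (mid p q) < 2"
      by (auto simp: bad_def pairs_def)
    show "e \<in> ?adj \<union> (?H True \<union> ?H False)"
    proof (rule ccontr)
      assume no: "e \<notin> ?adj \<union> (?H True \<union> ?H False)"
      then have nH: "\<not> lonely \<sigma> p r q" for \<sigma> r using e by (cases \<sigma>) auto
      obtain a where a: "a \<in> between p q" using pq e no by blast
      obtain r where r: "r \<in> mid p q" "ccw p q r \<longleftrightarrow> ccw p q a"
        using exists_empty[OF a] by (auto simp: mid_def)
      have uniq: "s = r" if "s \<in> mid p q" for s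
      proof (rule ccontr)
        assume "s \<noteq> r"
        then have "card {r, s} \<le> card (mid p q)"
          using that r finite_mid by (intro card_mono) auto
        then show False using c \<open>s \<noteq> r\<close> by simp
      qed
      \<comment> \<open>From any intermediate \<open>s\<close> the descent reaches an empty triangle
        on the side of \<open>s\<close>. Its apex can only be \<open>r\<close>, so all intermediate
        vertices are on the side of \<open>r\<close>.\<close>
      have "ccw p q s \<longleftrightarrow> ccw p q r" if "s \<in> between p q" for s
        using exists_empty[OF that] uniq by (auto simp: mid_def)
      moreover have "r \<in> between p q" using r(1) unfolding mid_def by blast
      moreover have "s = r" if "s \<in> between p q" "empty_tri p q s" for s
        using uniq that unfolding mid_def by blast
      ultimately have "lonely (ccw p q r) p r q" unfolding lonely_def by blast
      then show False using nH by blast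
    qed
  qed
  have HQ: "?H \<sigma> \<subseteq> pairs" for \<sigma> using rk_between(5) by (auto simp: pairs_def)
  have "inj_on fst ?adj"
  proof (rule inj_onI)
    fix x y assume xy: "x \<in> ?adj" "y \<in> ?adj" "fst x = fst y"
    then obtain p q q' where "x = (p, q)" "y = (p, q')" by (metis prod.collapse)
    moreover from this have "p \<sqsubset> q" "p \<sqsubset> q'" "\<not> q \<sqsubset> q'" "\<not> q' \<sqsubset> q"
      using xy by (auto simp: between_def)
    ultimately show "x = y" using lt_linear lt_dom by blast
  qed
  then have adj: "card ?adj \<le> card W"
    by (rule card_inj_on_le) (use lt_dom finite_W in auto)
  have adjf: "finite ?adj" by (rule finite_subset[OF _ finite_pairs]) (auto simp: pairs_def)
  have Hf: "finite (?H \<sigma>)" for \<sigma> by (rule finite_subset[OF HQ finite_pairs])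
  have "card bad \<le> card (?adj \<union> (?H True \<union> ?H False))"
    by (rule card_mono[OF _ sub]) (use adjf Hf in blast)
  also have "\<dots> \<le> card ?adj + (card (?H True) + card (?H False))"
    by (meson card_Un_le add_left_mono order_trans)
  \<comment> \<open>A left end has at most one immediate successor, which bounds the adjacent pairs
    by \<open>m\<close>; each of the two sides contributes at most
    \<open>2 * m * (1 + log 2 m)\<close> lonely pairs.\<close>
  finally have bad: "real (card bad) \<le> m + 4 * m * (1 + log 2 m)"
    using adj card_lonely[OF assms(1), of True] card_lonely[OF assms(1), of False]
    unfolding m_def by linarith
  have "2 * (card pairs - card bad) = (\<Sum>e\<in>pairs - bad. 2)"
    by (subst card_Diff_subset[symmetric]) (auto simp: bad_def intro: finite_subset[OF _ finite_pairs])
  also have "\<dots> \<le> (\<Sum>(p, q)\<in>pairs - bad. card (mid p q))"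
    by (rule sum_mono) (auto simp: bad_def)
  also have "\<dots> \<le> (\<Sum>(p, q)\<in>pairs. card (mid p q))"
    by (rule sum_mono2) (auto simp: finite_pairs)
  also have "\<dots> \<le> card empties" by (rule sum_mid_le)
  finally have "2 * card pairs \<le> card empties + 2 * card bad" by linarith
  then have "real (2 * card pairs) \<le> real (card empties + 2 * card bad)" by (rule of_nat_mono)
  then have "2 * (real (card pairs) - real (card bad)) \<le> real (card empties)" by simp
  moreover have "2 * real (card pairs) + m = m\<^sup>2"
    using card_pairs unfolding m_def power2_eq_square
    by (metis of_nat_add of_nat_mult of_nat_numeral)
  \<comment> \<open>Twice the number of pairs is \<open>m\<^sup>2 - m\<close>, and twice the bound
    for \<open>bad\<close> is \<open>10 * m + 8 * m * log 2 m\<close>. Together these give the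
    constants 11 and 8.\<close>
  ultimately show ?thesis using bad by (simp add: algebra_simps)
qed

end

section \<open>The bound in terms of the number of vertices\<close>

context triangle_system
begin

theorem card_empty_triangles:
  assumes "card V \<ge> 3"
  shows "real (card {T. T \<subseteq> V \<and> card T = 3 \<and> (\<forall>a b c v. T = {a, b, c} \<longrightarrow> \<not> ins v a b c)})
    \<ge> (real (card V))\<^sup>2 - 29 * real (card V) * ln (real (card V))"
proof -
  have "V \<noteq> {}" using assms by auto
  then obtain t where t: "t \<in> V" "\<And>a b c. \<not> ins t a b c"
    using exists_extreme[OF finite_V] ins_dom by (metis insert_subset order_refl)
  interpret triangle_system_extreme V ccw ins t
    using t by unfold_locales
  define n where "n = real (card V)"
  have n3: "n \<ge> 3" using assms by (simp add: n_def)
  have W: "real (card W) = n - 1" using t assms by (simp add: W_def n_def finite_V of_nat_diff)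
  then have "W \<noteq> {}" using n3 by auto
  from card_empties[OF this] have
    E: "real (card empties) \<ge> (n - 1)\<^sup>2 - 11 * (n - 1) - 8 * (n - 1) * log 2 (n - 1)"
    by (simp add: W)
  have "exp 1 \<le> n" using exp_le n3 by linarith
  then have "1 \<le> ln n" using n3 by (simp add: ln_ge_iff)
  then have nl: "n \<le> n * ln n" using n3 by simp
  have "ln 2 \<ge> (1/2 :: real)" using ln2_ge_two_thirds by simp
  have "log 2 (n - 1) \<le> log 2 n" using n3 by simp
  also have "\<dots> \<le> 2 * ln n"
    using \<open>ln 2 \<ge> 1/2\<close> \<open>1 \<le> ln n\<close> by (simp add: log_def field_simps)
  finally have "(n - 1) * log 2 (n - 1) \<le> n * (2 * ln n)"
    using n3 \<open>1 \<le> ln n\<close> by (intro mult_mono) auto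
  \<comment> \<open>The linear terms cost at most \<open>13 * n\<close> (2 from the square, 11 from
    \<open>E\<close>) and the logarithmic term at most \<open>16 * n * ln n\<close>. As
    \<open>n\<close> exceeds \<open>exp 1\<close>, the former are absorbed by
    \<open>13 * n * ln n\<close>, whence 29.\<close>
  with E nl have "real (card empties) \<ge> n\<^sup>2 - 29 * n * ln n"
    by (simp add: power2_eq_square algebra_simps)
  then show ?thesis by (simp add: empties_def n_def)
qed

end

section \<open>Triangles in plane drawings\<close>

text \<open>The drawing after projection, with edges as parametrised arcs so that winding numbers
  make sense. \<open>edge_reverse\<close> lets the two directions of an edge cancel exactly.\<close>

locale plane_drawing =
  fixes V :: "'a set" and P :: "'a \<Rightarrow> complex" and \<gamma> :: "'a \<Rightarrow> 'a \<Rightarrow> real \<Rightarrow> complex"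
  assumes finite_V: "finite V"
    and edge: "\<lbrakk>u \<in> V; v \<in> V; u \<noteq> v\<rbrakk> \<Longrightarrow> arc (\<gamma> u v) \<and> pathstart (\<gamma> u v) = P u \<and> pathfinish (\<gamma> u v) = P v"
    and edge_reverse: "\<lbrakk>u \<in> V; v \<in> V; u \<noteq> v\<rbrakk> \<Longrightarrow> \<gamma> v u = reversepath (\<gamma> u v)"
    and edge_adjacent: "\<lbrakk>{a, b, c} \<subseteq> V; distinct [a, b, c]\<rbrakk> \<Longrightarrow>
      path_image (\<gamma> a b) \<inter> path_image (\<gamma> a c) = {P a}"
    and edge_finite: "\<lbrakk>{a, b, c, d} \<subseteq> V; distinct [a, b, c, d]\<rbrakk> \<Longrightarrow>
      finite (path_image (\<gamma> a b) \<inter> path_image (\<gamma> c d))"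
begin

definition J where "J a b c = path_image (\<gamma> a b) \<union> path_image (\<gamma> b c) \<union> path_image (\<gamma> c a)"

definition loop where "loop a b c = \<gamma> a b +++ \<gamma> b c +++ \<gamma> c a"

text \<open>Off the triangle this is the winding number of \<open>loop a b c\<close>. Written as a
  sum over edges, it makes relations between several triangles a matter of cancelling terms.\<close>

definition turn :: "'a \<Rightarrow> 'a \<Rightarrow> 'a \<Rightarrow> complex \<Rightarrow> complex" where
  "turn a b c z = winding_number (\<gamma> a b) z + winding_number (\<gamma> b c) z + winding_number (\<gamma> c a) z"

text \<open>The winding number of a simple closed curve is constantly 1 or constantly -1 on its
  inside, so the negation means -1 throughout.\<close>

definition ccw where "ccw a b c \<longleftrightarrow> (\<forall>z\<in>inside (J a b c). turn a b c z = 1)"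

lemma edge_sym: "\<lbrakk>u \<in> V; v \<in> V; u \<noteq> v\<rbrakk> \<Longrightarrow> path_image (\<gamma> v u) = path_image (\<gamma> u v)"
  using edge_reverse[of u v] path_image_reversepath[of "\<gamma> u v"] by metis

lemma edge_ends: "\<lbrakk>u \<in> V; v \<in> V; u \<noteq> v\<rbrakk> \<Longrightarrow> P u \<in> path_image (\<gamma> u v) \<and> P v \<in> path_image (\<gamma> u v)"
  using edge by (metis pathfinish_in_path_image pathstart_in_path_image)

lemma edge_adjacent': "\<lbrakk>{a, b, c} \<subseteq> V; distinct [a, b, c]\<rbrakk> \<Longrightarrow>
      path_image (\<gamma> a b) \<inter> path_image (\<gamma> b c) = {P b}"
  using edge_adjacent[of b a c] edge_sym[of a b] by auto

lemma P_inj: "\<lbrakk>u \<in> V; v \<in> V; u \<noteq> v\<rbrakk> \<Longrightarrow> P u \<noteq> P v"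
  using edge arc_distinct_ends by metis

lemma vertex_off_edge:
  assumes "{a, b, c} \<subseteq> V" "distinct [a, b, c]"
  shows "P c \<notin> path_image (\<gamma> a b)"
proof -
  have "P c \<in> path_image (\<gamma> a c)" "P c \<noteq> P a" using edge_ends[of a c] P_inj[of a c] assms by auto
  then show ?thesis using edge_adjacent[OF assms] by blast
qed

lemma edge_path: "\<lbrakk>u \<in> V; v \<in> V; u \<noteq> v\<rbrakk> \<Longrightarrow> path (\<gamma> u v)"
  using edge arc_imp_path by blast

lemma closed_edge: "\<lbrakk>u \<in> V; v \<in> V; u \<noteq> v\<rbrakk> \<Longrightarrow> closed (path_image (\<gamma> u v))"
  using edge_path closed_path_image by blast

lemma J_perms:
  assumes "{a, b, c} \<subseteq> V" "distinct [a, b, c]"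
  shows "J b c a = J a b c" "J b a c = J a b c"
  using edge_sym[of a b] edge_sym[of b c] edge_sym[of c a] assms unfolding J_def by auto

context
  fixes a b c
  assumes abc: "{a, b, c} \<subseteq> V" "distinct [a, b, c]"
begin

lemma loop: "simple_path (loop a b c)" "pathfinish (loop a b c) = pathstart (loop a b c)"
  "path_image (loop a b c) = J a b c"
proof -
  have e: "arc (\<gamma> a b)" "arc (\<gamma> b c)" "arc (\<gamma> c a)" "pathstart (\<gamma> a b) = P a"
    "pathfinish (\<gamma> a b) = P b" "pathstart (\<gamma> b c) = P b" "pathfinish (\<gamma> b c) = P c"
    "pathstart (\<gamma> c a) = P c" "pathfinish (\<gamma> c a) = P a"
    using abc edge by auto
  have 1: "path_image (\<gamma> b c) \<inter> path_image (\<gamma> c a) = {P c}"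
    "path_image (\<gamma> a b) \<inter> path_image (\<gamma> b c) = {P b}"
    "path_image (\<gamma> c a) \<inter> path_image (\<gamma> a b) = {P a}"
    using abc by (auto intro!: edge_adjacent')
  have 2: "arc (\<gamma> b c +++ \<gamma> c a)"
    by (rule arc_join) (use e 1 in auto)
  show "simple_path (loop a b c)" unfolding loop_def
    by (rule simple_path_join_loop) (use e 1 2 in \<open>auto simp: path_image_join\<close>)
  show "pathfinish (loop a b c) = pathstart (loop a b c)" "path_image (loop a b c) = J a b c"
    using e by (auto simp: loop_def J_def path_image_join)
qed

lemma Jordan:
  "inside (J a b c) \<noteq> {}" "open (inside (J a b c))" "connected (inside (J a b c))"
  "outside (J a b c) \<noteq> {}" "open (outside (J a b c))" "connected (outside (J a b c))"
  "bounded (inside (J a b c))" "\<not> bounded (outside (J a b c))"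
  "inside (J a b c) \<inter> outside (J a b c) = {}" "inside (J a b c) \<union> outside (J a b c) = - J a b c"
  "frontier (inside (J a b c)) = J a b c" "frontier (outside (J a b c)) = J a b c"
  using Jordan_inside_outside[OF loop(1,2)] unfolding loop(3) by auto

lemma turn_loop:
  assumes "z \<notin> J a b c"
  shows "turn a b c z = winding_number (loop a b c) z"
proof -
  have "path (\<gamma> a b)" "path (\<gamma> b c)" "path (\<gamma> c a)" "z \<notin> path_image (\<gamma> a b)"
    "z \<notin> path_image (\<gamma> b c)" "z \<notin> path_image (\<gamma> c a)"
    "pathfinish (\<gamma> a b) = P b" "pathstart (\<gamma> b c) = P b" "pathfinish (\<gamma> b c) = P c"
    "pathstart (\<gamma> c a) = P c"
    using assms abc edge edge_path by (auto simp: J_def)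
  then show ?thesis
    by (simp add: turn_def loop_def winding_number_join path_image_join)
qed

lemma turn_outside: "z \<in> outside (J a b c) \<Longrightarrow> turn a b c z = 0"
  using turn_loop winding_number_zero_in_outside[of "loop a b c" z] loop
    simple_path_imp_path[OF loop(1)] outside_no_overlap by (metis disjoint_iff)

lemma turn_inside:
  assumes "z \<in> inside (J a b c)"
  shows "turn a b c z = (if ccw a b c then 1 else - 1)"
proof -
  have *: "turn a b c z = winding_number (loop a b c) z" if "z \<in> inside (J a b c)" for z
    by (rule turn_loop) (use inside_no_overlap that in blast)
  have "(\<forall>z\<in>inside (J a b c). turn a b c z = 1) \<or> (\<forall>z\<in>inside (J a b c). turn a b c z = -1)"
    using simple_closed_path_winding_number_inside[OF loop(1)] * unfolding loop(3) by metis
  then show ?thesis using assms by (auto simp: ccw_def)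
qed

lemma turn_constant:
  assumes "connected S" "S \<inter> J a b c = {}" "z \<in> S" "z' \<in> S"
  shows "turn a b c z = turn a b c z'"
proof -
  have "turn a b c x = winding_number (loop a b c) x" if "x \<in> S" for x
    by (rule turn_loop) (use that assms in blast)
  moreover have "winding_number (loop a b c) z = winding_number (loop a b c) z'"
    by (rule winding_number_eq[OF simple_path_imp_path[OF loop(1)] loop(2) assms(3,4,1)])
       (simp add: loop assms)
  ultimately show ?thesis using assms by simp
qed

lemma not_inside_iff: "z \<notin> J a b c \<Longrightarrow> z \<notin> inside (J a b c) \<longleftrightarrow> z \<in> outside (J a b c)"
  using Jordan(9,10) by blast

lemma ccw_iff: "z \<in> inside (J a b c) \<Longrightarrow> ccw a b c \<longleftrightarrow> turn a b c z = 1"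
  using turn_inside[of z] by (auto split: if_splits)

end

section \<open>Winding numbers and the axioms of a triangle system\<close>

lemma turn_rotate: "turn b c a z = turn a b c z"
  by (simp add: turn_def)

lemma winding_reverse:
  "\<lbrakk>u \<in> V; v \<in> V; u \<noteq> v; z \<notin> path_image (\<gamma> u v)\<rbrakk> \<Longrightarrow>
    winding_number (\<gamma> v u) z = - winding_number (\<gamma> u v) z"
  using edge_reverse[of u v] edge_path[of u v] winding_number_reversepath by metis

lemma turn_swap:
  assumes "{a, b, c} \<subseteq> V" "distinct [a, b, c]" "z \<notin> J a b c"
  shows "turn b a c z = - turn a b c z"
  using winding_reverse[of a b z] winding_reverse[of b c z] winding_reverse[of c a z] assms
  by (auto simp: turn_def J_def)

text \<open>On the right each edge at \<open>t\<close> occurs once in either direction and cancels,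
  leaving the three edges of \<open>pqr\<close>.\<close>

lemma turn_cocycle:
  assumes "{p, q, r, t} \<subseteq> V" "distinct [p, q, r, t]"
    "z \<notin> path_image (\<gamma> t p)" "z \<notin> path_image (\<gamma> t q)" "z \<notin> path_image (\<gamma> t r)"
  shows "turn p q r z = turn t p q z + turn t q r z + turn t r p z"
  using winding_reverse[of t p z] winding_reverse[of t q z] winding_reverse[of t r z] assms
  by (auto simp: turn_def)

lemma ccw_rotate:
  assumes "{a, b, c} \<subseteq> V" "distinct [a, b, c]"
  shows "ccw b c a \<longleftrightarrow> ccw a b c"
  by (simp only: ccw_def J_perms(1)[OF assms] turn_rotate[of b c a])

lemma ccw_swap:
  assumes "{a, b, c} \<subseteq> V" "distinct [a, b, c]"
  shows "ccw b a c \<longleftrightarrow> \<not> ccw a b c"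
proof -
  obtain z where z: "z \<in> inside (J a b c)" using Jordan(1)[OF assms] by blast
  have z': "z \<in> inside (J b a c)" using z J_perms[OF assms] by simp
  have "z \<notin> J a b c" using z inside_no_overlap by blast
  from turn_swap[OF assms this] show ?thesis
    using turn_inside[OF assms z] turn_inside[OF _ _ z'] assms by (auto split: if_splits)
qed

definition ins where
  "ins s a b c \<longleftrightarrow> distinct [s, a, b, c] \<and> {s, a, b, c} \<subseteq> V \<and> P s \<in> inside (J a b c)"

lemma ins_rotate: "ins s a b c \<Longrightarrow> ins s b c a"
  using J_perms(1)[of a b c] by (auto simp: ins_def)

lemma ins_swap: "ins s a b c \<Longrightarrow> ins s b a c"
  using J_perms(2)[of a b c] by (auto simp: ins_def)

lemma vertex_off_J:
  assumes "{s, a, b, c} \<subseteq> V" "distinct [s, a, b, c]"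
  shows "P s \<notin> J a b c"
  using vertex_off_edge[of a b s] vertex_off_edge[of b c s] vertex_off_edge[of c a s] assms
  by (auto simp: J_def)

lemma ins_iff_turn:
  assumes "{s, a, b, c} \<subseteq> V" "distinct [s, a, b, c]"
  shows "ins s a b c \<longleftrightarrow> turn a b c (P s) \<noteq> 0"
  using turn_inside[of a b c "P s"] turn_outside[of a b c "P s"]
    not_inside_iff[of a b c "P s"] vertex_off_J[OF assms] assms unfolding ins_def
  by (auto split: if_splits)

text \<open>If \<open>s\<close> were outside all three triangles at \<open>d\<close>, their winding
  numbers about it would vanish, and so, by the cocycle relation, would that of
  \<open>abc\<close>.\<close>

lemma ins_cover:
  assumes I: "ins s a b c" and d: "d \<in> V" "d \<notin> {s, a, b, c}"
  shows "ins s a b d \<or> ins s a c d \<or> ins s b c d"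
proof (rule ccontr)
  assume "\<not> ?thesis"
  then have n: "\<not> ins s a b d" "\<not> ins s c a d" "\<not> ins s b c d" using ins_swap by blast+
  have D: "distinct [s, a, b, c]" "{s, a, b, c} \<subseteq> V" using I by (auto simp: ins_def)
  have "turn a b d (P s) = 0" "turn c a d (P s) = 0" "turn b c d (P s) = 0"
    using n ins_iff_turn[of s a b d] ins_iff_turn[of s c a d] ins_iff_turn[of s b c d] D d by auto
  then have "turn d a b (P s) = 0" "turn d c a (P s) = 0" "turn d b c (P s) = 0"
    by (simp_all add: turn_rotate[of a b d] turn_rotate[of c a d] turn_rotate[of b c d])
  moreover have "turn a b c (P s) = turn d a b (P s) + turn d b c (P s) + turn d c a (P s)"
    by (rule turn_cocycle) (use D d vertex_off_edge in auto)
  ultimately show False using ins_iff_turn[of s a b c] I D by auto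
qed

text \<open>If \<open>t\<close> were outside \<open>pqr\<close>, a point \<open>z\<close> near
  \<open>t\<close> could be chosen outside \<open>pqr\<close> but inside \<open>tpq\<close>. There
  the cocycle relation would write 0 as a sum of nonnegative terms one of which is 1.\<close>

lemma ins_intro:
  assumes D: "distinct [t, p, q, r]" "{t, p, q, r} \<subseteq> V" and c: "ccw t p q" "ccw t q r" "ccw t r p"
  shows "ins t p q r"
proof (rule ccontr)
  assume "\<not> ins t p q r"
  have tpq: "{t, p, q} \<subseteq> V" "distinct [t, p, q]" and tqr: "{t, q, r} \<subseteq> V" "distinct [t, q, r]"
    and trp: "{t, r, p} \<subseteq> V" "distinct [t, r, p]" and pqr: "{p, q, r} \<subseteq> V" "distinct [p, q, r]"
    using D by auto
  have tJ: "P t \<notin> J p q r" using vertex_off_J D by blast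
  have out: "P t \<in> outside (J p q r)"
    using \<open>\<not> ins t p q r\<close> not_inside_iff[OF pqr tJ] D by (auto simp: ins_def)
  \<comment> \<open>\<open>P t\<close> is on the boundary of the inside of \<open>tpq\<close>, so
    its open neighbourhood \<open>outside (J p q r)\<close> contains points of that inside.\<close>
  have "P t \<in> frontier (inside (J t p q))"
    using Jordan(11)[OF tpq] edge_ends[of t p] tpq by (auto simp: J_def)
  then have "P t \<in> closure (inside (J t p q))" by (simp add: frontier_def)
  moreover have "open (outside (J p q r))" using Jordan(5)[OF pqr] .
  ultimately have "outside (J p q r) \<inter> inside (J t p q) \<noteq> {}"
    using out by (metis Int_commute closure_iff_nhds_not_empty order_refl)
  moreover have "open (outside (J p q r) \<inter> inside (J t p q))"
    using Jordan(5)[OF pqr] Jordan(2)[OF tpq] by blast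
  \<comment> \<open>A Jordan curve has no interior points, since it is the frontier of its inside.
    This allows \<open>z\<close> to avoid the remaining edge \<open>tr\<close> as well.\<close>
  moreover have "\<not> U \<subseteq> J t r p" if U: "U \<noteq> {}" "open U" for U
  proof
    assume "U \<subseteq> J t r p"
    then have "U \<subseteq> closure (inside (J t r p))" "U \<inter> inside (J t r p) = {}"
      using Jordan(11)[OF trp] inside_no_overlap[of "J t r p"] unfolding frontier_def by blast+
    then show False using U open_Int_closure_eq_empty[of U "inside (J t r p)"] by auto
  qed
  ultimately obtain z where z: "z \<in> outside (J p q r)" "z \<in> inside (J t p q)" "z \<notin> J t r p"
    by (meson IntD1 IntD2 subsetI)
  have "z \<notin> J t p q" using z inside_no_overlap by blast
  then have e: "z \<notin> path_image (\<gamma> t p)" "z \<notin> path_image (\<gamma> t q)" "z \<notin> path_image (\<gamma> t r)"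
    using z edge_sym[of t q] D by (auto simp: J_def)
  have "z \<notin> J p q r" using z outside_no_overlap by blast
  then have "z \<notin> J t q r" using e edge_sym[of t r] D by (auto simp: J_def)
  then have "turn t q r z = 0 \<or> turn t q r z = 1"
    using turn_inside[OF tqr, of z] turn_outside[OF tqr, of z] not_inside_iff[OF tqr, of z] c by auto
  moreover have "turn t r p z = 0 \<or> turn t r p z = 1"
    using turn_inside[OF trp, of z] turn_outside[OF trp, of z] not_inside_iff[OF trp, of z] c z by auto
  moreover have "turn t p q z = 1" using turn_inside[OF tpq z(2)] c by simp
  moreover have "turn p q r z = 0" by (rule turn_outside[OF pqr z(1)])
  moreover have "turn p q r z = turn t p q z + turn t q r z + turn t r p z"
    by (rule turn_cocycle) (use D e in auto)
  ultimately show False by auto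
qed

end

section \<open>Consequences of convexity\<close>

locale convex_plane_drawing = plane_drawing +
  assumes convex: "\<lbrakk>{a, b, c} \<subseteq> V; distinct [a, b, c]; u \<in> V; v \<in> V; u \<noteq> v;
      P u \<in> inside (J a b c) \<union> J a b c; P v \<in> inside (J a b c) \<union> J a b c\<rbrakk> \<Longrightarrow>
    path_image (\<gamma> u v) \<subseteq> inside (J a b c) \<union> J a b c"
begin

lemma ins_edges:
  assumes "ins s a b c"
  shows "path_image (\<gamma> s a) \<subseteq> inside (J a b c) \<union> J a b c"
  using assms convex[of a b c s a] edge_ends[of a b] by (auto simp: ins_def J_def)

text \<open>By convexity the curve \<open>sab\<close> stays in the closed disc of
  \<open>abc\<close>. So the outside of \<open>abc\<close> is a connected unbounded set that misses
  \<open>sab\<close>.\<close>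

lemma outside_mono_ins:
  assumes I: "ins s a b c"
  shows "outside (J a b c) \<subseteq> outside (J s a b)"
proof -
  have D: "distinct [s, a, b, c]" "{s, a, b, c} \<subseteq> V" using I by (auto simp: ins_def)
  have abc: "{a, b, c} \<subseteq> V" "distinct [a, b, c]" using D by auto
  have "path_image (\<gamma> s b) \<subseteq> inside (J a b c) \<union> J a b c"
    using ins_edges[OF ins_rotate[OF I]] J_perms[OF abc] by simp
  then have "J s a b \<subseteq> inside (J a b c) \<union> J a b c"
    using ins_edges[OF I] edge_sym[of s b] D by (auto simp: J_def)
  then have "outside (J a b c) \<subseteq> - J s a b"
    using Jordan(9,10)[OF abc] by blast
  then have sub: "outside (J a b c) \<subseteq> connected_component_set (- J s a b) x"
    if "x \<in> outside (J a b c)" for x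
    using Jordan(6)[OF abc] that by (intro connected_component_maximal)
  show ?thesis
  proof
    fix x assume x: "x \<in> outside (J a b c)"
    then have "\<not> bounded (connected_component_set (- J s a b) x)"
      using sub[OF x] Jordan(8)[OF abc] bounded_subset by blast
    then show "x \<in> outside (J s a b)"
      using x \<open>outside (J a b c) \<subseteq> - J s a b\<close> by (auto simp: outside_def)
  qed
qed

text \<open>The inside of \<open>sab\<close> is open and misses the outside of \<open>abc\<close>,
  hence also the closure of the latter, which contains the curve \<open>abc\<close>.\<close>

lemma inside_mono_ins:
  assumes I: "ins s a b c"
  shows "inside (J s a b) \<subseteq> inside (J a b c)"
proof
  have abc: "{a, b, c} \<subseteq> V" "distinct [a, b, c]" and sab: "{s, a, b} \<subseteq> V" "distinct [s, a, b]"
    using I by (auto simp: ins_def)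
  fix x assume x: "x \<in> inside (J s a b)"
  have disj: "inside (J s a b) \<inter> outside (J a b c) = {}"
    using outside_mono_ins[OF I] Jordan(9)[OF sab] by blast
  then have "inside (J s a b) \<inter> closure (outside (J a b c)) = {}"
    using open_Int_closure_eq_empty[OF Jordan(2)[OF sab]] by blast
  then have "x \<notin> J a b c" using x Jordan(12)[OF abc] by (auto simp: frontier_def)
  then show "x \<in> inside (J a b c)" using disj x not_inside_iff[OF abc] by blast
qed

lemma ins_trans:
  assumes I: "ins s a b c" and U: "ins u s a b"
  shows "ins u a b c"
proof -
  have abc: "{a, b, c} \<subseteq> V" "distinct [a, b, c]" using I by (auto simp: ins_def)
  have u: "P u \<in> inside (J a b c)" using inside_mono_ins[OF I] U by (auto simp: ins_def)
  moreover have "P c \<in> J a b c" using abc edge_ends[of b c] by (auto simp: J_def)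
  ultimately have "u \<noteq> c" using inside_no_overlap by blast
  then show ?thesis using I U u by (auto simp: ins_def)
qed

text \<open>Near a generic point of the edge \<open>ab\<close>, the triangles \<open>sbc\<close> and \<open>sca\<close> do not contribute
  to the winding number, so \<open>abc\<close> and \<open>sab\<close> wind alike there.\<close>

lemma ins_orient:
  assumes I: "ins s a b c"
  shows "ccw s a b \<longleftrightarrow> ccw a b c"
proof -
  have D: "distinct [s, a, b, c]" "{s, a, b, c} \<subseteq> V" using I by (auto simp: ins_def)
  have abc: "{a, b, c} \<subseteq> V" "distinct [a, b, c]" and sab: "{s, a, b} \<subseteq> V" "distinct [s, a, b]"
    and sbc: "{s, b, c} \<subseteq> V" "distinct [s, b, c]" and sca: "{s, c, a} \<subseteq> V" "distinct [s, c, a]"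
    using D by auto
  \<comment> \<open>Choice of the generic point \<open>m\<close>: an arc is infinite, but
    \<open>ab\<close> meets \<open>sc\<close> in finitely many points only.\<close>
  have "infinite (path_image (\<gamma> a b))"
    using connected_finite_iff_sing[of "path_image (\<gamma> a b)"] edge_ends[of a b] P_inj[of a b]
      connected_path_image[OF edge_path, of a b] abc by auto
  moreover have "finite (path_image (\<gamma> a b) \<inter> path_image (\<gamma> s c) \<union> {P a, P b})"
    using edge_finite[of a b s c] D by auto
  ultimately have "\<not> path_image (\<gamma> a b) \<subseteq> path_image (\<gamma> a b) \<inter> path_image (\<gamma> s c) \<union> {P a, P b}"
    using finite_subset by blast
  then obtain m where m: "m \<in> path_image (\<gamma> a b)" "m \<notin> path_image (\<gamma> s c)" "m \<noteq> P a" "m \<noteq> P b"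
    by blast
  define N where "N = path_image (\<gamma> s a) \<union> path_image (\<gamma> s b) \<union> path_image (\<gamma> s c) \<union>
    path_image (\<gamma> b c) \<union> path_image (\<gamma> c a)"
  have "path_image (\<gamma> a b) \<inter> path_image (\<gamma> s a) = {P a}"
    "path_image (\<gamma> a b) \<inter> path_image (\<gamma> s b) = {P b}"
    "path_image (\<gamma> a b) \<inter> path_image (\<gamma> b c) = {P b}"
    "path_image (\<gamma> a b) \<inter> path_image (\<gamma> c a) = {P a}"
    using edge_adjacent[of a b s] edge_adjacent[of a b c] edge_adjacent'[of a b s] edge_adjacent'[of a b c]
      edge_sym[of a s] edge_sym[of b s] edge_sym[of a c] D by auto
  then have "m \<notin> N" using m unfolding N_def by blast
  moreover have "closed N" unfolding N_def using closed_edge D by (intro closed_Un) auto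
  ultimately obtain e where e: "e > 0" "ball m e \<subseteq> - N"
    using open_contains_ball[of "- N"] by blast
  have "m \<in> J a b c" using m by (auto simp: J_def)
  then have "m \<in> closure (inside (J a b c))" "m \<in> closure (outside (J a b c))"
    using Jordan(11,12)[OF abc] by (auto simp: frontier_def)
  then obtain z z' where z: "z \<in> ball m e" "z \<in> outside (J a b c)"
    and z': "z' \<in> ball m e" "z' \<in> inside (J a b c)"
    using e(1) closure_approachable by (metis dist_commute mem_ball)
  \<comment> \<open>\<open>z\<close> and \<open>z'\<close> are outside and inside
    \<open>abc\<close>, yet the ball around \<open>m\<close> misses the curves \<open>sbc\<close>
    and \<open>sca\<close>. Their winding numbers are thus the same at both points, and they vanish
    at \<open>z\<close> because the outside of \<open>abc\<close> is outside both.\<close>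
  have "turn s b c z' = turn s b c z"
    using e(2) z(1) z'(1) edge_sym[of s c] D
    by (intro turn_constant[OF sbc connected_ball[of m e]]) (auto simp: J_def N_def)
  moreover have "z \<in> outside (J s b c)"
    using outside_mono_ins[OF ins_rotate[OF I]] J_perms[OF abc] z(2) by auto
  moreover have "turn s c a z' = turn s c a z"
    using e(2) z(1) z'(1) edge_sym[of s a] D
    by (intro turn_constant[OF sca connected_ball[of m e]]) (auto simp: J_def N_def)
  moreover have "z \<in> outside (J s c a)"
    using outside_mono_ins[OF ins_rotate[OF ins_rotate[OF I]]] J_perms(1)[OF abc] J_perms(1)[of b c a] D z(2)
    by auto
  ultimately have "turn s b c z' = 0" "turn s c a z' = 0"
    using turn_outside[OF sbc] turn_outside[OF sca] by auto
  moreover have "turn a b c z' = turn s a b z' + turn s b c z' + turn s c a z'"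
    by (rule turn_cocycle) (use D e(2) z'(1) in \<open>auto simp: N_def\<close>)
  ultimately have eq: "turn s a b z' = turn a b c z'" by simp
  have "z' \<notin> J a b c" using z' inside_no_overlap by blast
  then have "z' \<notin> J s a b"
    using e(2) z'(1) edge_sym[of s b] D by (auto simp: J_def N_def)
  moreover have "turn a b c z' \<noteq> 0" using turn_inside[OF abc z'(2)] by simp
  ultimately have "z' \<in> inside (J s a b)"
    using eq turn_outside[OF sab, of z'] not_inside_iff[OF sab, of z'] by auto
  then show ?thesis using ccw_iff[OF sab] ccw_iff[OF abc z'(2)] eq by simp
qed

end

section \<open>Transfer from the sphere\<close>

lemma connected_subset_clopen:
  assumes "connected A" "A \<subseteq> U" "A \<inter> X \<noteq> {}"
    and "openin (top_of_set U) X" "closedin (top_of_set U) X"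
  shows "A \<subseteq> X"
proof -
  obtain T1 T2 where "open T1" "X = U \<inter> T1" "closed T2" "X = U \<inter> T2"
    using assms(4,5) unfolding openin_open closedin_closed by blast
  then have "openin (top_of_set A) (A \<inter> X)" "closedin (top_of_set A) (A \<inter> X)"
    using assms(2) unfolding openin_open closedin_closed by blast+
  then show ?thesis using assms(1,3) unfolding connected_clopen by blast
qed

lemma homeomorphism_inj_on: "homeomorphism S T f g \<Longrightarrow> inj_on f S"
  by (rule inj_on_inverseI[of S g]) (rule homeomorphism_apply1)

lemma S2_punctured:
  assumes "z \<in> S2"
  obtains \<phi> \<psi> where "homeomorphism (S2 - {z}) (UNIV :: complex set) \<phi> \<psi>"
proof -
  have "(S2 - {z}) homeomorphic (UNIV :: complex set)"
    by (rule homeomorphic_punctured_sphere_affine) (use assms in auto)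
  then show ?thesis using that unfolding homeomorphic_def by blast
qed

lemma closed_disc_param:
  assumes "closed_disc_bounded_by \<Delta> K"
  obtains h where "continuous_on (cball 0 1) h" "inj_on h (cball (0::complex) 1)"
    "h ` cball 0 1 = \<Delta>" "h ` sphere 0 1 = K" "h ` ball 0 1 = \<Delta> - K"
proof -
  obtain h :: "complex \<Rightarrow> real ^ 3" and k where
    h: "homeomorphism (cball 0 1) \<Delta> h k" "h ` sphere 0 1 = K"
    using assms unfolding closed_disc_bounded_by_def by blast
  have inj: "inj_on h (cball 0 1)"
    by (rule homeomorphism_inj_on[OF h(1)])
  have "h ` (cball 0 1 - sphere 0 1) = h ` cball 0 1 - h ` sphere 0 1"
    by (rule inj_on_image_set_diff[OF inj]) auto
  moreover have "cball (0::complex) 1 - sphere 0 1 = ball 0 1" by auto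
  ultimately have "h ` ball 0 1 = \<Delta> - K"
    using h(2) homeomorphism_image1[OF h(1)] by simp
  then show ?thesis
    using that inj h(2) homeomorphism_image1[OF h(1)] homeomorphism_cont1[OF h(1)] by blast
qed

lemma closed_disc_simps:
  assumes "closed_disc_bounded_by \<Delta> K"
  shows "compact \<Delta>" "K \<subseteq> \<Delta>" "\<Delta> \<subseteq> S2" "connected (\<Delta> - K)" "\<Delta> - K \<noteq> {}" "K \<noteq> {}"
proof -
  obtain h where h: "continuous_on (cball 0 1) h" "inj_on h (cball (0::complex) 1)"
    "h ` cball 0 1 = \<Delta>" "h ` sphere 0 1 = K" "h ` ball 0 1 = \<Delta> - K"
    using closed_disc_param[OF assms] .
  show "\<Delta> \<subseteq> S2" using assms unfolding closed_disc_bounded_by_def by blast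
  show "compact \<Delta>" using h(1,3) compact_continuous_image compact_cball by metis
  show "K \<subseteq> \<Delta>" using h(3,4) sphere_cball by blast
  have "continuous_on (ball 0 1) h" using h(1) ball_subset_cball continuous_on_subset by blast
  then show "connected (\<Delta> - K)" using h(5) connected_continuous_image[OF _ connected_ball] by metis
  have "ball (0::complex) 1 \<noteq> {}" by simp
  then show "\<Delta> - K \<noteq> {}" using h(5) by blast
  have "sphere (0::complex) 1 \<noteq> {}" by simp
  then show "K \<noteq> {}" using h(4) by blast
qed

text \<open>Invariance of domain, applied to the parametrisation of the disc followed by the chart.
  The centre \<open>z\<close> may lie on the boundary \<open>K\<close>, which the next lemma
  exploits.\<close>

lemma open_chart_disc_interior:
  assumes "closed_disc_bounded_by \<Delta> K" "homeomorphism (S2 - {z}) (UNIV :: complex set) \<phi> \<psi>"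
    "z \<notin> \<Delta> - K"
  shows "open (\<phi> ` (\<Delta> - K))"
proof -
  obtain h where h: "continuous_on (cball 0 1) h" "inj_on h (cball (0::complex) 1)"
    "h ` ball 0 1 = \<Delta> - K"
    using closed_disc_param[OF assms(1)] .
  have sub: "\<Delta> - K \<subseteq> S2 - {z}" using closed_disc_simps(3)[OF assms(1)] assms(3) by blast
  have "open ((\<phi> \<circ> h) ` ball 0 1)"
  proof (rule invariance_of_domain)
    have "continuous_on (ball 0 1) h" using h(1) ball_subset_cball continuous_on_subset by blast
    then show "continuous_on (ball 0 1) (\<phi> \<circ> h)"
      using homeomorphism_cont1[OF assms(2)] sub h(3) continuous_on_compose continuous_on_subset by metis
    have "inj_on \<phi> (S2 - {z})" by (rule homeomorphism_inj_on[OF assms(2)])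
    then have "inj_on \<phi> (h ` ball 0 1)" using sub h(3) inj_on_subset by metis
    moreover have "inj_on h (ball 0 1)" using h(2) ball_subset_cball inj_on_subset by blast
    ultimately show "inj_on (\<phi> \<circ> h) (ball 0 1)" using comp_inj_on by blast
  qed auto
  then show ?thesis using h(3) by (metis image_comp)
qed

text \<open>The chart is centred at a boundary point \<open>w\<close>, so its domain contains the
  whole open disc, whichever disc is given.\<close>

lemma openin_disc_interior:
  assumes "closed_disc_bounded_by \<Delta> K"
  shows "openin (top_of_set S2) (\<Delta> - K)"
proof -
  note d = closed_disc_simps[OF assms]
  obtain w where w: "w \<in> K" using d(6) by blast
  then obtain \<phi> \<psi> where hom: "homeomorphism (S2 - {w}) (UNIV :: complex set) \<phi> \<psi>"
    using S2_punctured d(2,3) by blast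
  have sub: "\<Delta> - K \<subseteq> S2 - {w}" using d(3) w by blast
  have "open (\<phi> ` (\<Delta> - K))" by (rule open_chart_disc_interior[OF assms hom]) (use w in blast)
  then have "openin (top_of_set UNIV) (\<phi> ` (\<Delta> - K))" by simp
  from homeomorphism_imp_open_map[OF homeomorphism_symD[OF hom] this]
  have "openin (top_of_set (S2 - {w})) (\<psi> ` \<phi> ` (\<Delta> - K))" .
  moreover have "\<psi> ` \<phi> ` (\<Delta> - K) = \<Delta> - K"
    using sub homeomorphism_apply1[OF hom] by force
  moreover have "openin (top_of_set S2) (S2 - {w})" by (rule openin_delete) simp
  ultimately show ?thesis using openin_trans by metis
qed

lemma disc_interior_clopen:
  assumes "closed_disc_bounded_by \<Delta> K"
  shows "openin (top_of_set (S2 - K)) (\<Delta> - K)" "closedin (top_of_set (S2 - K)) (\<Delta> - K)"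
proof -
  note d = closed_disc_simps[OF assms]
  show "openin (top_of_set (S2 - K)) (\<Delta> - K)"
    using openin_disc_interior[OF assms] by (rule openin_subset_trans) (use d in auto)
  have "\<Delta> - K = (S2 - K) \<inter> \<Delta>" using d by blast
  then show "closedin (top_of_set (S2 - K)) (\<Delta> - K)"
    using compact_imp_closed[OF d(1)] closedin_closed by metis
qed

text \<open>The open disc is connected and clopen in the complement of \<open>K\<close>. Hence at
  most one open disc bounded by \<open>K\<close> contains a given point.\<close>

lemma disc_interior_component:
  assumes "closed_disc_bounded_by \<Delta> K" "z \<in> \<Delta> - K"
  shows "\<Delta> - K = connected_component_set (S2 - K) z"
proof
  note d = closed_disc_simps[OF assms(1)]
  show "\<Delta> - K \<subseteq> connected_component_set (S2 - K) z"
    by (rule connected_component_maximal) (use assms d in auto)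
  have "z \<in> S2 - K" using assms d by blast
  then have "z \<in> connected_component_set (S2 - K) z" using connected_component_refl_eq by simp
  then have "connected_component_set (S2 - K) z \<inter> (\<Delta> - K) \<noteq> {}"
    using assms(2) by blast
  then show "connected_component_set (S2 - K) z \<subseteq> \<Delta> - K"
    by (rule connected_subset_clopen[OF connected_connected_component connected_component_subset
          _ disc_interior_clopen[OF assms(1)]])
qed

text \<open>The image of the open disc is clopen in the complement of the curve and bounded. It
  therefore misses the connected unbounded outside and fills the connected inside.\<close>

lemma chart_disc_interior:
  assumes disc: "closed_disc_bounded_by \<Delta> K"
    and hom: "homeomorphism (S2 - {z}) (UNIV :: complex set) \<phi> \<psi>" and z: "z \<notin> \<Delta>"
    and c: "simple_path c" "pathfinish c = pathstart c" "path_image c = \<phi> ` K"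
  shows "\<phi> ` (\<Delta> - K) = inside (\<phi> ` K)"
proof -
  note d = closed_disc_simps[OF disc]
  have J: "connected (inside (\<phi> ` K))" "connected (outside (\<phi> ` K))"
    "\<not> bounded (outside (\<phi> ` K))" "inside (\<phi> ` K) \<union> outside (\<phi> ` K) = - \<phi> ` K"
    using Jordan_inside_outside[OF c(1,2)] unfolding c(3) by blast+
  let ?X = "\<phi> ` (\<Delta> - K)"
  have sub: "\<Delta> \<subseteq> S2 - {z}" using d(3) z by blast
  have cont: "continuous_on \<Delta> \<phi>" using homeomorphism_cont1[OF hom] sub continuous_on_subset by blast
  have inj: "inj_on \<phi> \<Delta>" using homeomorphism_inj_on[OF hom] sub inj_on_subset by blast
  have dis: "?X \<inter> \<phi> ` K = {}"
    using inj d(2) by (auto dest: inj_onD)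
  have comp: "compact (\<phi> ` \<Delta>)" by (rule compact_continuous_image[OF cont d(1)])
  have "?X = - \<phi> ` K \<inter> \<phi> ` \<Delta>" using dis d(2) by blast
  then have closed: "closedin (top_of_set (- \<phi> ` K)) ?X"
    using compact_imp_closed[OF comp] closedin_closed by metis
  have "open ?X" by (rule open_chart_disc_interior[OF disc hom]) (use z in blast)
  then have opn: "openin (top_of_set (- \<phi> ` K)) ?X"
    using dis by (metis disjoint_eq_subset_Compl open_openin_trans open_subset)
  have bdd: "bounded ?X" using comp compact_imp_bounded bounded_subset image_mono Diff_subset by metis
  have "?X \<inter> outside (\<phi> ` K) = {}"
  proof (rule ccontr)
    assume "?X \<inter> outside (\<phi> ` K) \<noteq> {}"
    then have "outside (\<phi> ` K) \<inter> ?X \<noteq> {}" by blast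
    moreover have "outside (\<phi> ` K) \<subseteq> - \<phi> ` K" using J(4) by blast
    ultimately have "outside (\<phi> ` K) \<subseteq> ?X"
      by (intro connected_subset_clopen[OF J(2) _ _ opn closed])
    then show False using bdd J bounded_subset by blast
  qed
  then have "?X \<subseteq> inside (\<phi> ` K)" using J dis by blast
  moreover from this have "inside (\<phi> ` K) \<inter> ?X \<noteq> {}" using d(5) by blast
  moreover have "inside (\<phi> ` K) \<subseteq> - \<phi> ` K" using J(4) by blast
  moreover from calculation have "inside (\<phi> ` K) \<subseteq> ?X"
    by (intro connected_subset_clopen[OF J(1) _ _ opn closed])
  ultimately show ?thesis by blast
qed

sublocale convex_plane_drawing \<subseteq> tri: triangle_system V ccw ins
proof (rule triangle_system.intro, goal_cases)
  case 1 show ?case by (rule finite_V)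
next
  case 2 then show ?case using ccw_rotate by blast
next
  case 3 then show ?case using ccw_swap by blast
next
  case 4 then show ?case unfolding ins_def by blast
next
  case 5 then show ?case by (rule ins_rotate)
next
  case 6 then show ?case by (rule ins_swap)
next
  case 7 then show ?case by (rule ins_orient)
next
  case 8 then show ?case by (rule ins_trans)
next
  case 9 then show ?case by (rule ins_cover)
next
  case 10 then show ?case by (rule ins_intro)
qed

section \<open>Projecting a face-convex drawing from a point of the face\<close>

locale face_convex_drawing =
  fixes n :: nat and D :: drawing and F :: "(real ^ 3) set" and z\<^sub>0 :: "real ^ 3"
    and \<phi> :: "real ^ 3 \<Rightarrow> complex" and \<psi> :: "complex \<Rightarrow> real ^ 3"
  assumes good: "good_drawing n D" and face: "F \<in> faces n D" and z\<^sub>0: "z\<^sub>0 \<in> F"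
    and convex_discs: "\<forall>T\<in>triangles n.
      \<exists>\<Delta>. closed_disc_bounded_by \<Delta> (subdrawing D T) \<and> \<not> F \<subseteq> \<Delta> \<and> convex_disc n D \<Delta>"
    and chart: "homeomorphism (S2 - {z\<^sub>0}) (UNIV :: complex set) \<phi> \<psi>"
begin

definition P where "P = \<phi> \<circ> vertex D"

definition edge_path where
  "edge_path u v = (SOME g. arc g \<and> pathstart g = vertex D u \<and> pathfinish g = vertex D v \<and>
     path_image g = edge D {u, v})"

text \<open>The arcs chosen for \<open>(u, v)\<close> and \<open>(v, u)\<close> may have unrelated
  parametrisations. Taking only the one with \<open>u < v\<close> and reversing it makes
  \<open>edge_reverse\<close> an exact equation.\<close>

definition \<gamma> where
  "\<gamma> u v = \<phi> \<circ> (if u < v then edge_path u v else reversepath (edge_path v u))"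

lemma drawing_edges:
  shows "\<forall>u<n. \<forall>v<n. u \<noteq> v \<longrightarrow> (\<exists>g. arc g \<and> pathstart g = vertex D u \<and>
     pathfinish g = vertex D v \<and> path_image g = edge D {u, v})"
  "vertex D ` {..<n} \<subseteq> S2"
  "\<forall>e\<in>complete_edges {..<n}. edge D e \<subseteq> S2 \<and> (\<forall>w<n. w \<notin> e \<longrightarrow> vertex D w \<notin> edge D e)"
  "\<forall>e\<in>complete_edges {..<n}. \<forall>f\<in>complete_edges {..<n}. e \<noteq> f \<longrightarrow>
     edge D e \<inter> edge D f \<subseteq> vertex D ` (e \<inter> f) \<union> {p. crosses_at (edge D e) (edge D f) p} \<and>
     finite {p. crosses_at (edge D e) (edge D f) p}"
  "\<forall>e\<in>complete_edges {..<n}. \<forall>f\<in>complete_edges {..<n}. e \<noteq> f \<and> e \<inter> f \<noteq> {} \<longrightarrow>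
     \<not> (\<exists>p. crosses_at (edge D e) (edge D f) p)"
proof -
  note * = good[unfolded good_drawing_def is_drawing_def]
  show "\<forall>u<n. \<forall>v<n. u \<noteq> v \<longrightarrow> (\<exists>g. arc g \<and> pathstart g = vertex D u \<and>
     pathfinish g = vertex D v \<and> path_image g = edge D {u, v})"
    using * by (elim conjE)
  show "vertex D ` {..<n} \<subseteq> S2"
    using * by (elim conjE)
  show "\<forall>e\<in>complete_edges {..<n}. edge D e \<subseteq> S2 \<and> (\<forall>w<n. w \<notin> e \<longrightarrow> vertex D w \<notin> edge D e)"
    using * by (elim conjE)
  show "\<forall>e\<in>complete_edges {..<n}. \<forall>f\<in>complete_edges {..<n}. e \<noteq> f \<longrightarrow>
     edge D e \<inter> edge D f \<subseteq> vertex D ` (e \<inter> f) \<union> {p. crosses_at (edge D e) (edge D f) p} \<and>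
     finite {p. crosses_at (edge D e) (edge D f) p}"
    using * by (elim conjE)
  show "\<forall>e\<in>complete_edges {..<n}. \<forall>f\<in>complete_edges {..<n}. e \<noteq> f \<and> e \<inter> f \<noteq> {} \<longrightarrow>
     \<not> (\<exists>p. crosses_at (edge D e) (edge D f) p)"
    using * by (elim conjE)
qed

lemma edge_path:
  assumes "u < n" "v < n" "u \<noteq> v"
  shows "arc (edge_path u v)" "pathstart (edge_path u v) = vertex D u"
    "pathfinish (edge_path u v) = vertex D v" "path_image (edge_path u v) = edge D {u, v}"
proof -
  have ex: "\<exists>g. arc g \<and> pathstart g = vertex D u \<and> pathfinish g = vertex D v \<and>
    path_image g = edge D {u, v}"
    using drawing_edges(1) assms by simp
  have "arc (edge_path u v) \<and> pathstart (edge_path u v) = vertex D u \<and>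
    pathfinish (edge_path u v) = vertex D v \<and> path_image (edge_path u v) = edge D {u, v}"
    unfolding edge_path_def by (rule someI_ex[OF ex])
  then show "arc (edge_path u v)" "pathstart (edge_path u v) = vertex D u"
    "pathfinish (edge_path u v) = vertex D v" "path_image (edge_path u v) = edge D {u, v}"
    by blast+
qed

lemma pair_edge: "\<lbrakk>u < n; v < n; u \<noteq> v\<rbrakk> \<Longrightarrow> {u, v} \<in> complete_edges {..<n}"
  by (simp add: complete_edges_def)

lemma face_disjoint: "z\<^sub>0 \<in> S2" "F \<subseteq> S2 - subdrawing D {..<n}" "connected F"
  using face z\<^sub>0 in_components_subset in_components_connected unfolding faces_def by blast+

lemma edge_chart:
  assumes "u < n" "v < n" "u \<noteq> v"
  shows "edge D {u, v} \<subseteq> S2 - {z\<^sub>0}"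
proof -
  have "edge D {u, v} \<subseteq> S2"
    using drawing_edges(3) pair_edge[OF assms] by blast
  moreover have "edge D {u, v} \<subseteq> subdrawing D {..<n}"
    using pair_edge[OF assms] unfolding subdrawing_def by blast
  ultimately show ?thesis using face_disjoint z\<^sub>0 by blast
qed

lemma vertex_chart: "u < n \<Longrightarrow> vertex D u \<in> S2 - {z\<^sub>0}"
proof -
  assume u: "u < n"
  then have "vertex D u \<in> S2" using drawing_edges(2) by blast
  moreover have "vertex D u \<in> subdrawing D {..<n}" using u unfolding subdrawing_def by blast
  ultimately show ?thesis using face_disjoint z\<^sub>0 by blast
qed

lemma inj_\<phi>: "inj_on \<phi> (S2 - {z\<^sub>0})"
  by (rule homeomorphism_inj_on[OF chart])

lemma adjacent_edges:
  assumes "{a, b, c} \<subseteq> {..<n}" "distinct [a, b, c]"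
  shows "edge D {a, b} \<inter> edge D {a, c} = {vertex D a}"
proof -
  have e: "{a, b} \<in> complete_edges {..<n}" "{a, c} \<in> complete_edges {..<n}" "{a, b} \<noteq> {a, c}"
    "{a, b} \<inter> {a, c} = {a}"
    using assms pair_edge by (auto simp: doubleton_eq_iff)
  have "edge D {a, b} \<inter> edge D {a, c} \<subseteq> vertex D ` ({a, b} \<inter> {a, c}) \<union>
      {p. crosses_at (edge D {a, b}) (edge D {a, c}) p}"
    using drawing_edges(4)[rule_format, OF e(1-3)] by (rule conjunct1)
  moreover have "{p. crosses_at (edge D {a, b}) (edge D {a, c}) p} = {}"
  proof -
    have "{a, b} \<inter> {a, c} \<noteq> {}" by blast
    then have "\<not> (\<exists>p. crosses_at (edge D {a, b}) (edge D {a, c}) p)"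
      using drawing_edges(5)[rule_format, OF e(1,2)] e(3) by simp
    then show ?thesis by simp
  qed
  moreover have "vertex D a \<in> edge D {a, b}" "vertex D a \<in> edge D {a, c}"
    using pathstart_in_path_image[of "edge_path a b"] pathstart_in_path_image[of "edge_path a c"]
      edge_path[of a b] edge_path[of a c] assms by simp_all
  ultimately show ?thesis unfolding e(4) by auto
qed

lemma disjoint_edges_finite:
  assumes "{a, b, c, d} \<subseteq> {..<n}" "distinct [a, b, c, d]"
  shows "finite (edge D {a, b} \<inter> edge D {c, d})"
proof -
  have e: "{a, b} \<in> complete_edges {..<n}" "{c, d} \<in> complete_edges {..<n}" "{a, b} \<noteq> {c, d}"
    using assms pair_edge by (auto simp: doubleton_eq_iff)
  have "edge D {a, b} \<inter> edge D {c, d} \<subseteq> vertex D ` ({a, b} \<inter> {c, d}) \<union>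
      {p. crosses_at (edge D {a, b}) (edge D {c, d}) p}"
    "finite {p. crosses_at (edge D {a, b}) (edge D {c, d}) p}"
    using drawing_edges(4)[rule_format, OF e] by (rule conjunct1, rule conjunct2)
  then show ?thesis using finite_subset by (metis finite_Un finite_imageI finite_Int finite.intros)
qed

lemma path_image_\<gamma>:
  assumes "u < n" "v < n" "u \<noteq> v"
  shows "path_image (\<gamma> u v) = \<phi> ` edge D {u, v}"
proof -
  have "{v, u} = {u, v}" by blast
  then show ?thesis
    using edge_path(4)[of u v] edge_path(4)[of v u] assms by (simp add: \<gamma>_def path_image_compose)
qed

lemma arc_\<gamma>:
  assumes "u < n" "v < n" "u \<noteq> v"
  shows "arc (\<gamma> u v) \<and> pathstart (\<gamma> u v) = P u \<and> pathfinish (\<gamma> u v) = P v"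
proof -
  define g where "g = (if u < v then edge_path u v else reversepath (edge_path v u))"
  have "{v, u} = {u, v}" by blast
  then have g: "arc g" "pathstart g = vertex D u" "pathfinish g = vertex D v" "path_image g = edge D {u, v}"
    using edge_path[of u v] edge_path[of v u] assms by (auto simp: g_def arc_reversepath)
  have sub: "path_image g \<subseteq> S2 - {z\<^sub>0}" using g(4) edge_chart[OF assms] by simp
  have "path (\<phi> \<circ> g)"
    using homeomorphism_cont1[OF chart] sub continuous_on_subset arc_imp_path[OF g(1)]
    by (intro path_continuous_image) blast+
  moreover have "inj_on (\<phi> \<circ> g) {0..1}"
    using arc_imp_inj_on[OF g(1)] inj_on_subset[OF inj_\<phi> sub] unfolding path_image_def
    by (rule comp_inj_on)
  ultimately have "arc (\<phi> \<circ> g)" by (simp add: arc_def)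
  moreover have "\<gamma> u v = \<phi> \<circ> g" by (simp add: \<gamma>_def g_def)
  ultimately show ?thesis using g(2,3) by (simp add: pathstart_compose pathfinish_compose P_def)
qed

lemma image_Int_chart:
  assumes "A \<subseteq> S2 - {z\<^sub>0}" "B \<subseteq> S2 - {z\<^sub>0}"
  shows "\<phi> ` A \<inter> \<phi> ` B = \<phi> ` (A \<inter> B)"
  using inj_on_image_Int[OF inj_\<phi> assms] by simp

sublocale plane_drawing "{..<n}" P \<gamma>
proof
  show "finite {..<n}" by simp
  show "arc (\<gamma> u v) \<and> pathstart (\<gamma> u v) = P u \<and> pathfinish (\<gamma> u v) = P v"
    if "u \<in> {..<n}" "v \<in> {..<n}" "u \<noteq> v" for u v using arc_\<gamma> that by simp
  show "\<gamma> v u = reversepath (\<gamma> u v)" if "u \<in> {..<n}" "v \<in> {..<n}" "u \<noteq> v" for u v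
    using that by (simp add: \<gamma>_def path_compose_reversepath)
  show "path_image (\<gamma> a b) \<inter> path_image (\<gamma> a c) = {P a}"
    if "{a, b, c} \<subseteq> {..<n}" "distinct [a, b, c]" for a b c
    using that adjacent_edges[OF that] edge_chart[of a b] edge_chart[of a c]
    by (simp add: path_image_\<gamma> image_Int_chart P_def)
  show "finite (path_image (\<gamma> a b) \<inter> path_image (\<gamma> c d))"
    if "{a, b, c, d} \<subseteq> {..<n}" "distinct [a, b, c, d]" for a b c d
    using that disjoint_edges_finite[OF that] edge_chart[of a b] edge_chart[of c d]
    by (simp add: path_image_\<gamma> image_Int_chart)
qed

lemma subdrawing_triple:
  assumes "{a, b, c} \<subseteq> {..<n}" "distinct [a, b, c]"
  shows "\<phi> ` subdrawing D {a, b, c} = J a b c"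
proof -
  have "complete_edges {a, b, c} = {{a, b}, {b, c}, {c, a}}" (is "?L = ?R")
  proof
    show "?L \<subseteq> ?R"
      by (auto simp: complete_edges_def card_2_iff doubleton_eq_iff)
    show "?R \<subseteq> ?L" using assms(2) by (auto simp: complete_edges_def)
  qed
  then have "\<phi> ` subdrawing D {a, b, c} = {P a, P b, P c} \<union> J a b c"
    using assms path_image_\<gamma>[of a b] path_image_\<gamma>[of b c] path_image_\<gamma>[of c a]
    by (auto simp: subdrawing_def J_def image_Un P_def)
  moreover have "{P a, P b, P c} \<subseteq> J a b c"
    using edge_ends[of a b] edge_ends[of b c] assms by (auto simp: J_def)
  ultimately show ?thesis by blast
qed

lemma triangle_cases:
  assumes "T \<in> triangles n"
  obtains a b c where "T = {a, b, c}" "{a, b, c} \<subseteq> {..<n}" "distinct [a, b, c]"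
  using assms unfolding triangles_def card_3_iff by auto

lemma disc_inside:
  assumes T: "T \<in> triangles n" and disc: "closed_disc_bounded_by \<Delta> (subdrawing D T)" and z: "z\<^sub>0 \<notin> \<Delta>"
  shows "\<phi> ` (\<Delta> - subdrawing D T) = inside (\<phi> ` subdrawing D T)"
proof -
  obtain a b c where abc: "T = {a, b, c}" "{a, b, c} \<subseteq> {..<n}" "distinct [a, b, c]"
    using triangle_cases[OF T] .
  show ?thesis
    using chart_disc_interior[OF disc chart z loop(1)[OF abc(2,3)] loop(2)[OF abc(2,3)]]
      loop(3)[OF abc(2,3)] subdrawing_triple[OF abc(2,3)] abc(1) by simp
qed

lemma subdrawing_mono: "T \<subseteq> {..<n} \<Longrightarrow> subdrawing D T \<subseteq> subdrawing D {..<n}"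
  unfolding subdrawing_def complete_edges_def by blast

text \<open>The face is connected and misses the triangle, so it would lie entirely in a disc
  containing one of its points \<open>z\<^sub>0\<close>.\<close>

lemma convex_disc_exists:
  assumes T: "T \<in> triangles n"
  obtains \<Delta> where "closed_disc_bounded_by \<Delta> (subdrawing D T)" "z\<^sub>0 \<notin> \<Delta>" "convex_disc n D \<Delta>"
proof -
  obtain \<Delta> where \<Delta>: "closed_disc_bounded_by \<Delta> (subdrawing D T)" "\<not> F \<subseteq> \<Delta>" "convex_disc n D \<Delta>"
    using convex_discs T by blast
  have FK: "F \<subseteq> S2 - subdrawing D T"
    using face_disjoint(2) subdrawing_mono[of T] T unfolding triangles_def by blast
  have "z\<^sub>0 \<notin> \<Delta>"
  proof
    assume "z\<^sub>0 \<in> \<Delta>"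
    then have "F \<inter> (\<Delta> - subdrawing D T) \<noteq> {}" using FK z\<^sub>0 by blast
    then have "F \<subseteq> \<Delta> - subdrawing D T"
      by (rule connected_subset_clopen[OF face_disjoint(3) FK _ disc_interior_clopen[OF \<Delta>(1)]])
    then show False using \<Delta>(2) by blast
  qed
  then show ?thesis using that \<Delta> by blast
qed

text \<open>Finiteness matters because \<open>card\<close> is 0 on infinite sets. A triangle bounds
  at most two open discs: one avoiding \<open>z\<^sub>0\<close>, which corresponds to the inside of
  the projected curve, and the component of \<open>z\<^sub>0\<close>.\<close>

lemma finite_empty_triangles: "finite (empty_triangles n D)"
proof -
  define X where "X T = {\<psi> ` inside (\<phi> ` subdrawing D T),
    connected_component_set (S2 - subdrawing D T) z\<^sub>0}" for T
  have "\<Delta> \<in> X T" if T: "T \<in> triangles n" and \<Delta>: "open_disc_bounded_by \<Delta> (subdrawing D T)" for T \<Delta>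
  proof -
    obtain \<Delta>' where \<Delta>': "closed_disc_bounded_by \<Delta>' (subdrawing D T)" "\<Delta> = \<Delta>' - subdrawing D T"
      using \<Delta> unfolding open_disc_bounded_by_def by blast
    show ?thesis
    proof (cases "z\<^sub>0 \<in> \<Delta>'")
      case True
      moreover have "z\<^sub>0 \<notin> subdrawing D T"
        using face_disjoint(2) z\<^sub>0 subdrawing_mono[of T] T unfolding triangles_def by blast
      ultimately show ?thesis using disc_interior_component[OF \<Delta>'(1), of z\<^sub>0] \<Delta>'(2) by (simp add: X_def)
    next
      case False
      have "\<Delta> \<subseteq> S2 - {z\<^sub>0}" using closed_disc_simps(3)[OF \<Delta>'(1)] \<Delta>'(2) False by blast
      then have "\<psi> ` \<phi> ` \<Delta> = \<Delta>" using homeomorphism_apply1[OF chart] by force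
      then have "\<Delta> = \<psi> ` inside (\<phi> ` subdrawing D T)"
        using disc_inside[OF T \<Delta>'(1) False] \<Delta>'(2) by simp
      then show ?thesis by (simp add: X_def)
    qed
  qed
  then have "empty_triangles n D \<subseteq> (\<Union>T\<in>triangles n. X T)"
    unfolding empty_triangles_def by blast
  moreover have "triangles n \<subseteq> Pow {..<n}" unfolding triangles_def by blast
  then have "finite (triangles n)" using finite_subset by blast
  ultimately show ?thesis by (auto intro: finite_subset simp: X_def)
qed

text \<open>The chart maps the convex disc avoiding \<open>z\<^sub>0\<close> onto the projected
  triangle together with its inside, and injectivity of the chart carries membership of vertices
  back to the sphere.\<close>

sublocale convex_plane_drawing "{..<n}" P \<gamma>
proof
  fix a b c u v
  assume abc: "{a, b, c} \<subseteq> {..<n}" "distinct [a, b, c]" and uv: "u \<in> {..<n}" "v \<in> {..<n}" "u \<noteq> v"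
    and P: "P u \<in> inside (J a b c) \<union> J a b c" "P v \<in> inside (J a b c) \<union> J a b c"
  have T: "{a, b, c} \<in> triangles n" using abc by (simp add: triangles_def)
  obtain \<Delta> where \<Delta>: "closed_disc_bounded_by \<Delta> (subdrawing D {a, b, c})" "z\<^sub>0 \<notin> \<Delta>" "convex_disc n D \<Delta>"
    using convex_disc_exists[OF T] .
  have "\<phi> ` \<Delta> = \<phi> ` (\<Delta> - subdrawing D {a, b, c}) \<union> \<phi> ` subdrawing D {a, b, c}"
    using closed_disc_simps(2)[OF \<Delta>(1)] by blast
  then have img: "\<phi> ` \<Delta> = inside (J a b c) \<union> J a b c"
    using disc_inside[OF T \<Delta>(1,2)] subdrawing_triple[OF abc] by simp
  have sub: "\<Delta> \<subseteq> S2 - {z\<^sub>0}" using closed_disc_simps(3)[OF \<Delta>(1)] \<Delta>(2) by blast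
  have "vertex D w \<in> \<Delta>" if "w < n" "P w \<in> \<phi> ` \<Delta>" for w
    using inj_on_image_mem_iff[OF inj_\<phi> vertex_chart[OF that(1)] sub] that(2) by (simp add: P_def)
  then have "edge D {u, v} \<subseteq> \<Delta>"
    using \<Delta>(3) uv P unfolding img[symmetric] convex_disc_def by blast
  then show "path_image (\<gamma> u v) \<subseteq> inside (J a b c) \<union> J a b c"
    using path_image_\<gamma>[of u v] uv img by auto
qed

section \<open>From empty triples to empty discs\<close>

definition empty_triples where
  "empty_triples = {T. T \<subseteq> {..<n} \<and> card T = 3 \<and> (\<forall>a b c v. T = {a, b, c} \<longrightarrow> \<not> ins v a b c)}"

text \<open>Each empty triple is sent to its open disc that avoids \<open>z\<^sub>0\<close>. The
  other discs are not counted, which is harmless for a lower bound.\<close>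

lemma card_empty_triples: "card empty_triples \<le> card (empty_triangles n D)"
proof (rule card_inj_on_le)
  define X where "X T = \<psi> ` inside (\<phi> ` subdrawing D T)" for T
  have \<phi>X: "\<phi> ` X T = inside (\<phi> ` subdrawing D T)" for T
    unfolding X_def image_image using homeomorphism_apply2[OF chart] by simp
  have tri: "empty_triples \<subseteq> triangles n" by (auto simp: empty_triples_def triangles_def)
  show "finite (empty_triangles n D)" by (rule finite_empty_triangles)
  show "inj_on X empty_triples"
  proof (rule inj_onI)
    fix T T' assume TT: "T \<in> empty_triples" "T' \<in> empty_triples" "X T = X T'"
    \<comment> \<open>Injectivity: the triple is recovered from its disc as the set of vertices on
      the frontier of the projected disc.\<close>
    have *: "T = {v. v < n \<and> P v \<in> frontier (\<phi> ` X T)}" if T: "T \<in> triangles n" for T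
    proof -
      obtain a b c where abc: "T = {a, b, c}" "{a, b, c} \<subseteq> {..<n}" "distinct [a, b, c]"
        using triangle_cases[OF T] .
      have fr: "frontier (\<phi> ` X T) = J a b c"
        using \<phi>X Jordan(11)[OF abc(2,3)] subdrawing_triple[OF abc(2,3)] abc(1) by simp
      have "P a \<in> J a b c" "P b \<in> J a b c" "P c \<in> J a b c"
        using edge_ends[of a b] edge_ends[of b c] abc by (auto simp: J_def)
      moreover have "P v \<notin> J a b c" if "v < n" "v \<notin> {a, b, c}" for v
        using vertex_off_J[of v a b c] that abc by auto
      ultimately show ?thesis using abc fr by auto
    qed
    show "T = T'" using *[of T] *[of T'] TT tri by auto
  qed
  show "X ` empty_triples \<subseteq> empty_triangles n D"
  proof (rule image_subsetI)
    fix T assume T: "T \<in> empty_triples"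
    then have T3: "T \<in> triangles n" using tri by blast
    obtain \<Delta> where \<Delta>: "closed_disc_bounded_by \<Delta> (subdrawing D T)" "z\<^sub>0 \<notin> \<Delta>"
      using convex_disc_exists[OF T3] .
    have "\<Delta> - subdrawing D T \<subseteq> S2 - {z\<^sub>0}" using closed_disc_simps(3)[OF \<Delta>(1)] \<Delta>(2) by blast
    then have "\<psi> ` \<phi> ` (\<Delta> - subdrawing D T) = \<Delta> - subdrawing D T"
      using homeomorphism_apply1[OF chart] by force
    then have XT: "X T = \<Delta> - subdrawing D T"
      using disc_inside[OF T3 \<Delta>] by (simp add: X_def)
    obtain a b c where abc: "T = {a, b, c}" "{a, b, c} \<subseteq> {..<n}" "distinct [a, b, c]"
      using triangle_cases[OF T3] .
    have "vertex D v \<notin> X T" if v: "v < n" for v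
    proof
      assume vX: "vertex D v \<in> X T"
      have "P v \<in> inside (J a b c)"
        using vX \<phi>X[of T] subdrawing_triple[OF abc(2,3)] abc(1) by (auto simp: P_def)
      moreover have "v \<notin> T" using vX unfolding XT subdrawing_def by blast
      ultimately have "ins v a b c" using abc v by (auto simp: ins_def)
      then show False using T abc(1) unfolding empty_triples_def by blast
    qed
    then show "X T \<in> empty_triangles n D"
      using T3 \<Delta>(1) XT unfolding empty_triangles_def open_disc_bounded_by_def by blast
  qed
qed

end

theorem corollary4p6:
  "\<exists>C::real. \<forall>n::nat. n \<ge> 3 \<longrightarrow>
     (\<forall>D. good_drawing n D \<and> face_convex n D \<longrightarrow>
        real (card (empty_triangles n D)) \<ge> (real n)\<^sup>2 - C * real n * ln (real n))"
proof (intro exI[of _ 29] allI impI)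
  fix n :: nat and D
  assume n: "n \<ge> 3" and D: "good_drawing n D \<and> face_convex n D"
  then obtain F where F: "F \<in> faces n D" "\<forall>T\<in>triangles n.
      \<exists>\<Delta>. closed_disc_bounded_by \<Delta> (subdrawing D T) \<and> \<not> F \<subseteq> \<Delta> \<and> convex_disc n D \<Delta>"
    unfolding face_convex_def by blast
  then obtain z where z: "z \<in> F" using in_components_nonempty unfolding faces_def by blast
  then have "z \<in> S2" using F(1) in_components_subset unfolding faces_def by blast
  then obtain \<phi> \<psi> where "homeomorphism (S2 - {z}) (UNIV :: complex set) \<phi> \<psi>"
    using S2_punctured by blast
  then interpret face_convex_drawing n D F z \<phi> \<psi>
    using D F z by unfold_locales auto
  have "real (card empty_triples) \<ge> (real n)\<^sup>2 - 29 * real n * ln (real n)"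
    using tri.card_empty_triangles n by (simp add: empty_triples_def)
  then show "real (card (empty_triangles n D)) \<ge> (real n)\<^sup>2 - 29 * real n * ln (real n)"
    using card_empty_triples by linarith
qed

end
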